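(* Let $(P,e)$, $P\in\mathcal{T}_k$, be a staggered tree pattern with signature $(\alpha_1,\dots,\alpha_\ell;\beta_1,\dots,\beta_{\ell-1})$ satisfying: (i) if $\ell>1$ and $\beta_1=\alpha_1$, then $\alpha_1\in\{1,2\}$; (ii) $\beta_i<\alpha_i$ for all $i=2,\dots,\ell-1$. Then for every $n\ge0$ the map $\varphi_L\colon\mathcal{T}_n(P,e)\to\mathcal{P}_n(1212,\varphi_L(P))$ is a bijection.
   Context: $\mathcal{T}_n$ is the set of binary trees on $n$ vertices labeled $1,\dots,n$ by the search tree property; $c_L,c_R,p$ are left child, right child, parent; $r(P)$ root; $P(j)$ the subtree rooted at $j$. A tree pattern is $(P,e)$, $P\in\mathcal{T}_k$, $e\colon[k]\setminus\{r(P)\}\to\{0,1\}$ ($e(i)=1$: edge to parent contiguous, $e(i)=0$: non-contiguous); $e_{P(j)}$ is the restriction of $e$ to the non-root vertices of $P(j)$. $T\in\mathcal{T}_n$ contains $(P,e)$ if there is an injection $f\colon[k]\to[n]$ such that for each non-root $i$ of $P$: if $e(i)=1$, $f(i)$ is the left (resp. right) child of $f(p(i))$ when $i$ is the left (resp. right) child of $p(i)$; if $e(i)=0$, $f(i)$ lies in the left (resp. right) subtree of $f(p(i))$. $\mathcal{T}_n(P,e)$ is the set of avoiders. Staggered patterns (recursive): $(P,e)$ is staggered if either $P$ is a left path (no vertex has a right child) with all edges contiguous, or the left branch $r(P),c_L(r(P)),c_L^2(r(P)),\dots$ starting at the root has all edges contiguous, exactly one vertex $i$ on this branch has a right child $j=c_R(i)$,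 $e(j)=0$, and $(P(j),e_{P(j)})$ is staggered. Its signature $(\alpha_1,\dots,\alpha_\ell;\beta_1,\dots,\beta_{\ell-1})$: the pattern decomposes into $\ell$ contiguous left branches (the first starting at the root, the $(m+1)$-st starting at the right child of the distinguished vertex of the $m$-th); $\alpha_m$ is the number of vertices of the $m$-th branch, and the distinguished vertex (having a right child) of the $m$-th branch, $m<\ell$, is the $\beta_m$-th vertex counted from bottom to top. For a binary tree $T$ on $[n]$, $\varphi_L(T)$ is the set partition of $[n]$ into vertex sets of the maximal left branches of $T$ (maximal sequences $v,c_L(v),c_L^2(v),\dots$), written as its restricted growth string (RGS): order blocks by smallest element, $x_i=j$ if $i$ is in the $j$-th block. $\mathcal{P}_n$ is the set of RGS of length $n$. A string $x$ contains a pattern string $\tau_1\cdots\tau_m$ if there are $i_1<\dots<i_m$ with $x_{i_a}<x_{i_b}\iff\tau_a<\tau_b$ and $x_{i_a}=x_{i_b}\iff\tau_a=\tau_b$; $\mathcal{P}_n(1212,\varphi_L(P))$ is the set of RGS avoiding both $1212$ and the string $\varphi_L(P)$. *)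

theory Defs
  imports Main "HOL-Library.Tree"
begin

definition bst_trees :: "nat \<Rightarrow> nat tree set" where
  "bst_trees n = {t. inorder t = [1..<n+1]}"

fun lchild :: "nat tree \<Rightarrow> nat \<Rightarrow> nat \<Rightarrow> bool" where
  "lchild Leaf u v = False"
| "lchild (Node l x r) u v =
     ((v = x \<and> l \<noteq> Leaf \<and> u = value l) \<or> lchild l u v \<or> lchild r u v)"

fun rchild :: "nat tree \<Rightarrow> nat \<Rightarrow> nat \<Rightarrow> bool" where
  "rchild Leaf u v = False"
| "rchild (Node l x r) u v =
     ((v = x \<and> r \<noteq> Leaf \<and> u = value r) \<or> rchild l u v \<or> rchild r u v)"

fun in_lsub :: "nat tree \<Rightarrow> nat \<Rightarrow> nat \<Rightarrow> bool" where
  "in_lsub Leaf u v = False"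
| "in_lsub (Node l x r) u v =
     ((v = x \<and> u \<in> set_tree l) \<or> in_lsub l u v \<or> in_lsub r u v)"

fun in_rsub :: "nat tree \<Rightarrow> nat \<Rightarrow> nat \<Rightarrow> bool" where
  "in_rsub Leaf u v = False"
| "in_rsub (Node l x r) u v =
     ((v = x \<and> u \<in> set_tree r) \<or> in_rsub l u v \<or> in_rsub r u v)"

(* T contains the tree pattern (P,e); e i = True means the edge from i to its
   parent is contiguous, e i = False non-contiguous (values of e at the root
   or outside the vertex set of P are irrelevant). *)
definition contains_pattern :: "nat tree \<Rightarrow> nat tree \<Rightarrow> (nat \<Rightarrow> bool) \<Rightarrow> bool" where
  "contains_pattern T P e \<longleftrightarrow>
     (\<exists>f. inj_on f (set_tree P) \<and> f ` set_tree P \<subseteq> set_tree T \<and>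
        (\<forall>i p. lchild P i p \<longrightarrow>
            (if e i then lchild T (f i) (f p) else in_lsub T (f i) (f p))) \<and>
        (\<forall>i p. rchild P i p \<longrightarrow>
            (if e i then rchild T (f i) (f p) else in_rsub T (f i) (f p))))"

definition avoiders :: "nat \<Rightarrow> nat tree \<Rightarrow> (nat \<Rightarrow> bool) \<Rightarrow> nat tree set" where
  "avoiders n P e = {T \<in> bst_trees n. \<not> contains_pattern T P e}"

fun spine :: "'a tree \<Rightarrow> 'a tree list" where
  "spine Leaf = []"
| "spine (Node l x r) = Node l x r # spine l"

(* stag e t as bs : the pattern (t,e) is staggered with signature
   (as_1,...,as_l ; bs_1,...,bs_{l-1}).  The distinguished vertex is the
   p-th vertex from the top (0-based), i.e. the (length - p)-th from the bottom. *)
inductive stag :: "(nat \<Rightarrow> bool) \<Rightarrow> nat tree \<Rightarrow> nat list \<Rightarrow> nat list \<Rightarrow> bool"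
  for e :: "nat \<Rightarrow> bool" where
  leftpath:
    "t \<noteq> Leaf \<Longrightarrow> (\<forall>s\<in>set (spine t). right s = Leaf) \<Longrightarrow>
     (\<forall>s\<in>set (tl (spine t)). e (value s)) \<Longrightarrow>
     stag e t [length (spine t)] []"
| step:
    "t \<noteq> Leaf \<Longrightarrow> (\<forall>s\<in>set (tl (spine t)). e (value s)) \<Longrightarrow>
     p < length (spine t) \<Longrightarrow> right (spine t ! p) \<noteq> Leaf \<Longrightarrow>
     (\<forall>q<length (spine t). q \<noteq> p \<longrightarrow> right (spine t ! q) = Leaf) \<Longrightarrow>
     \<not> e (value (right (spine t ! p))) \<Longrightarrow>
     stag e (right (spine t ! p)) as bs \<Longrightarrow>
     stag e t (length (spine t) # as) ((length (spine t) - p) # bs)"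

definition left_blocks :: "nat tree \<Rightarrow> nat set set" where
  "left_blocks T = {B. \<exists>v\<in>set_tree T. (\<not> (\<exists>u. lchild T v u)) \<and>
                        B = {w. (\<lambda>a b. lchild T b a)\<^sup>*\<^sup>* v w}}"

(* restricted growth string of a set partition of {1..n}: blocks ordered by
   their smallest element, x_i = j iff i lies in the j-th block *)
definition rgs_of :: "nat \<Rightarrow> nat set set \<Rightarrow> nat list" where
  "rgs_of n \<Pi> = map (\<lambda>i. card {B \<in> \<Pi>. Min B \<le> Min (THE B. B \<in> \<Pi> \<and> i \<in> B)}) [1..<n+1]"

definition phiL :: "nat \<Rightarrow> nat tree \<Rightarrow> nat list" where
  "phiL n T = rgs_of n (left_blocks T)"

definition is_rgs :: "nat list \<Rightarrow> bool" where
  "is_rgs x \<longleftrightarrow> (\<forall>i<length x. 1 \<le> x ! i \<and> x ! i \<le> Suc (Max (insert 0 (set (take i x)))))"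

definition contains_word :: "nat list \<Rightarrow> nat list \<Rightarrow> bool" where
  "contains_word x \<tau> \<longleftrightarrow>
     (\<exists>idx. length idx = length \<tau> \<and> sorted_wrt (<) idx \<and> (\<forall>a\<in>set idx. a < length x) \<and>
        (\<forall>a<length \<tau>. \<forall>b<length \<tau>.
           (x ! (idx ! a) < x ! (idx ! b) \<longleftrightarrow> \<tau> ! a < \<tau> ! b) \<and>
           (x ! (idx ! a) = x ! (idx ! b) \<longleftrightarrow> \<tau> ! a = \<tau> ! b)))"

definition rgs_avoiding :: "nat \<Rightarrow> nat list \<Rightarrow> nat list set" where
  "rgs_avoiding n \<sigma> = {x. length x = n \<and> is_rgs x \<and>
      \<not> contains_word x [1,2,1,2] \<and> \<not> contains_word x \<sigma>}"

end

theory Submission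
  imports Defs
begin

text \<open>
  Replace every letter of the restricted growth string of \<open>T\<close> by the least element of its block.
  This relabelling is strictly monotone, and the new label of a vertex is computed inside any subtree
  containing that vertex, so containment of \<open>\<phi>\<^sub>L(P)\<close> in \<open>\<phi>\<^sub>L(T)\<close> becomes the existence of a strictly
  increasing map from \<open>P\<close> to \<open>T\<close> that preserves the order of block minima.

  An occurrence of the tree pattern is always such a map. Conversely, a branch of \<open>P\<close> whose
  distinguished vertex lies below its top encloses everything hanging off it, so the subpattern is sent
  into a single right subtree of a vertex \<open>z\<close> of the host branch. Choosing the vertices of that branch
  consecutively around \<open>z\<close> gives a contiguous occurrence. If the distinguished vertex of the first
  branch is its top, one climbs from the image of the subpattern until reaching a vertex with a left
  child (if \<open>\<alpha>\<^sub>1 = 2\<close>). Finally, \<open>\<phi>\<^sub>L\<close> is a bijection from binary search trees to noncrossing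
  partitions, since the root is the largest element of the first block.
\<close>

section \<open>Occurrences of patterns in trees\<close>

text \<open>\<open>bmin T v\<close> is the least vertex of the maximal left branch of \<open>T\<close> through \<open>v\<close>; it is
  meaningful only for search trees \<open>T\<close> and vertices \<open>v\<close> of \<open>T\<close>.\<close>

fun bmin :: "nat tree \<Rightarrow> nat \<Rightarrow> nat" where
  "bmin Leaf v = v"
| "bmin (Node l x r) v =
     (if v < x then bmin l v else if v = x then (if l = Leaf then x else bmin l (value l))
      else bmin r v)"

text \<open>Embeddings sending root to root, for patterns all of whose left edges are contiguous and all of
  whose right edges are non-contiguous.\<close>

fun rooted_at :: "nat tree \<Rightarrow> nat tree \<Rightarrow> bool" where
  "rooted_at Leaf T = True"
| "rooted_at (Node p x q) Leaf = False"
| "rooted_at (Node p x q) (Node l y r) =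
     (rooted_at p l \<and> (\<exists>S\<in>subtrees r. rooted_at q S))"

definition occurs_in :: "nat tree \<Rightarrow> nat tree \<Rightarrow> bool" where
  "occurs_in P T \<longleftrightarrow> (\<exists>S\<in>subtrees T. rooted_at P S)"

definition tree_emb :: "nat tree \<Rightarrow> nat tree \<Rightarrow> (nat \<Rightarrow> nat) \<Rightarrow> bool" where
  "tree_emb P T f \<longleftrightarrow> f ` set_tree P \<subseteq> set_tree T \<and>
     (\<forall>i p. lchild P i p \<longrightarrow> lchild T (f i) (f p)) \<and>
     (\<forall>i p. rchild P i p \<longrightarrow> in_rsub T (f i) (f p))"

text \<open>Containment of \<open>phiL k P\<close> in \<open>phiL n T\<close>, read on vertices:
  strict monotonicity encodes increasing positions, and comparing block minima for all ordered pairs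
  also settles equality of letters.\<close>

definition word_emb :: "nat tree \<Rightarrow> nat tree \<Rightarrow> (nat \<Rightarrow> nat) \<Rightarrow> bool" where
  "word_emb P T f \<longleftrightarrow> f ` set_tree P \<subseteq> set_tree T \<and> strict_mono_on (set_tree P) f \<and>
     (\<forall>i\<in>set_tree P. \<forall>j\<in>set_tree P. bmin T (f i) < bmin T (f j) \<longleftrightarrow> bmin P i < bmin P j)"

section \<open>Elementary properties of block minima\<close>

lemma value_in_set_tree: "t \<noteq> Leaf \<Longrightarrow> value t \<in> set_tree t"
  by (cases t) auto

lemma bmin_in: "bst t \<Longrightarrow> v \<in> set_tree t \<Longrightarrow> bmin t v \<in> set_tree t"
  by (induction t arbitrary: v) (auto simp: value_in_set_tree)

text \<open>The left branch starting at the root ends in the leftmost vertex, which is the minimum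
  of the whole tree.\<close>

lemma bmin_root_le: "bst t \<Longrightarrow> v \<in> set_tree t \<Longrightarrow> bmin t (value t) \<le> v"
proof (induction t arbitrary: v)
  case (Node l x r)
  have "l \<noteq> Leaf \<Longrightarrow> bmin l (value l) < x" using Node.prems bmin_in[of l "value l"]
    by (auto simp: value_in_set_tree)
  then show ?case using Node by (fastforce)
qed simp

lemma bmin_root_le_bmin: "bst t \<Longrightarrow> v \<in> set_tree t \<Longrightarrow> bmin t (value t) \<le> bmin t v"
  using bmin_root_le bmin_in by blast

lemma bmin_le: "bst t \<Longrightarrow> v \<in> set_tree t \<Longrightarrow> bmin t v \<le> v"
proof (induction t arbitrary: v)
  case (Node l x r)
  then show ?case using bmin_root_le[OF Node.prems(1), of x] by auto
qed simp

lemma bmin_bmin_root: "bst t \<Longrightarrow> t \<noteq> Leaf \<Longrightarrow> bmin t (bmin t (value t)) = bmin t (value t)"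
proof -
  assume a: "bst t" "t \<noteq> Leaf"
  then have "bmin t (value t) \<in> set_tree t" by (simp add: bmin_in value_in_set_tree)
  then show ?thesis using a bmin_le bmin_root_le_bmin by (simp add: le_antisym)
qed

lemma bmin_idem: "bst t \<Longrightarrow> v \<in> set_tree t \<Longrightarrow> bmin t (bmin t v) = bmin t v"
proof (induction t arbitrary: v)
  case (Node l x r)
  have ?case if "v \<in> set_tree l" using that Node bmin_in[of l v] by auto
  moreover have ?case if "v \<in> set_tree r" using that Node bmin_in[of r v] by force
  moreover have ?case if "v = x" using bmin_bmin_root[of "Node l x r"] Node.prems that by simp
  ultimately show ?case using Node.prems by auto
qed simp

section \<open>Passing to subtrees\<close>

lemma bst_subtree: "bst T \<Longrightarrow> S \<in> subtrees T \<Longrightarrow> bst S"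
  by (induction T) auto

lemma set_subtree: "S \<in> subtrees T \<Longrightarrow> set_tree S \<subseteq> set_tree T"
  by (induction T) auto

lemma Leaf_in_subtrees: "Leaf \<in> subtrees T" by (induction T) auto
lemma self_in_subtrees: "T \<in> subtrees T" by (cases T) auto

text \<open>The left branch through \<open>v\<close> may extend above \<open>S\<close>, but its
  lower end, where the minimum sits, lies in \<open>S\<close>.\<close>

lemma bmin_subtree: "bst T \<Longrightarrow> S \<in> subtrees T \<Longrightarrow> v \<in> set_tree S \<Longrightarrow> bmin T v = bmin S v"
proof (induction T)
  case (Node l x r)
  consider "S = Node l x r" | "S \<in> subtrees l" | "S \<in> subtrees r" using Node.prems by auto
  then show ?case
  proof cases
    case 2 then have "v \<in> set_tree l" using Node.prems set_subtree by blast
    then show ?thesis using 2 Node by auto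
  next
    case 3 then have "v \<in> set_tree r" using Node.prems set_subtree by blast
    then have "v > x" using Node.prems by auto
    then show ?thesis using 3 Node by auto
  qed simp
qed simp

lemma lchild_in: "lchild T u v \<Longrightarrow> u \<in> set_tree T \<and> v \<in> set_tree T"
  by (induction T) (auto simp: value_in_set_tree)
lemma rchild_in: "rchild T u v \<Longrightarrow> u \<in> set_tree T \<and> v \<in> set_tree T"
  by (induction T) (auto simp: value_in_set_tree)
lemma in_rsub_in: "in_rsub T u v \<Longrightarrow> u \<in> set_tree T \<and> v \<in> set_tree T"
  by (induction T) auto

lemma lchild_subtree: "S \<in> subtrees T \<Longrightarrow> lchild S u v \<Longrightarrow> lchild T u v"
  by (induction T) auto
lemma in_rsub_subtree: "S \<in> subtrees T \<Longrightarrow> in_rsub S u v \<Longrightarrow> in_rsub T u v"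
  by (induction T) auto

text \<open>Labels of a search tree are distinct, so \<open>v\<close> occurs in \<open>T\<close>
  only inside \<open>S\<close>, and everything below it is there too.\<close>

lemma lchild_restrict:
  "bst T \<Longrightarrow> S \<in> subtrees T \<Longrightarrow> v \<in> set_tree S \<Longrightarrow> lchild T u v \<Longrightarrow> lchild S u v"
proof (induction T)
  case (Node l x r)
  consider "S = Node l x r" | "S \<in> subtrees l" | "S \<in> subtrees r" using Node.prems by auto
  then show ?case
  proof cases
    case 2 then have "v \<in> set_tree l" using Node.prems set_subtree by blast
    then show ?thesis using 2 Node lchild_in[of r u v] by force
  next
    case 3 then have "v \<in> set_tree r" using Node.prems set_subtree by blast
    then show ?thesis using 3 Node lchild_in[of l u v] by force
  qed (use Node in simp)
qed simp

lemma in_rsub_restrict: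
  "bst T \<Longrightarrow> S \<in> subtrees T \<Longrightarrow> v \<in> set_tree S \<Longrightarrow> in_rsub T u v \<Longrightarrow> in_rsub S u v"
proof (induction T)
  case (Node l x r)
  consider "S = Node l x r" | "S \<in> subtrees l" | "S \<in> subtrees r" using Node.prems by auto
  then show ?case
  proof cases
    case 2 then have "v \<in> set_tree l" using Node.prems set_subtree by blast
    then show ?thesis using 2 Node in_rsub_in[of r u v] by force
  next
    case 3 then have "v \<in> set_tree r" using Node.prems set_subtree by blast
    then show ?thesis using 3 Node in_rsub_in[of l u v] by force
  qed (use Node in simp)
qed simp

text \<open>Children are sent below the image of their parent, so the image stays in
  \<open>S\<close> once the image of the root does.\<close>

lemma tree_emb_restrict:
  assumes "bst T" "S \<in> subtrees T"
  shows "tree_emb P T f \<Longrightarrow> (P \<noteq> Leaf \<Longrightarrow> f (value P) \<in> set_tree S) \<Longrightarrow> tree_emb P S f"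
proof (induction P)
  case (Node p x r)
  have sub: "tree_emb p T f" "tree_emb r T f"
    using Node.prems(1) unfolding tree_emb_def by auto
  have x: "f x \<in> set_tree S" using Node.prems by simp
  have "p \<noteq> Leaf \<Longrightarrow> f (value p) \<in> set_tree S"
    using Node.prems(1) lchild_restrict[OF assms x] lchild_in unfolding tree_emb_def by fastforce
  then have p: "f ` set_tree p \<subseteq> set_tree S" using Node.IH(1) sub(1) tree_emb_def by blast
  have "r \<noteq> Leaf \<Longrightarrow> f (value r) \<in> set_tree S"
    using Node.prems(1) in_rsub_restrict[OF assms x] in_rsub_in unfolding tree_emb_def by fastforce
  then have r: "f ` set_tree r \<subseteq> set_tree S" using Node.IH(2) sub(2) tree_emb_def by blast
  have im: "f ` set_tree (Node p x r) \<subseteq> set_tree S" using p r x by auto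
  have "lchild S (f i) (f j)" if "lchild (Node p x r) i j" for i j
  proof -
    have "f j \<in> set_tree S" using lchild_in[OF that] im by blast
    moreover have "lchild T (f i) (f j)" using Node.prems(1) that unfolding tree_emb_def by blast
    ultimately show ?thesis using lchild_restrict assms by blast
  qed
  moreover have "in_rsub S (f i) (f j)" if "rchild (Node p x r) i j" for i j
  proof -
    have "f j \<in> set_tree S" using rchild_in[OF that] im by blast
    moreover have "in_rsub T (f i) (f j)" using Node.prems(1) that unfolding tree_emb_def by blast
    ultimately show ?thesis using in_rsub_restrict assms by blast
  qed
  ultimately show ?case using im unfolding tree_emb_def by blast
qed (simp add: tree_emb_def)

section \<open>Embeddings of trees and rooted occurrences\<close>

lemma subtree_at: "v \<in> set_tree T \<Longrightarrow> \<exists>S\<in>subtrees T. S \<noteq> Leaf \<and> value S = v"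
  by (induction T) force+

text \<open>A contiguous left edge forces the left subpattern onto the left child, while the right
  subpattern may be rooted at any vertex \<open>f (value q)\<close> of the right subtree.\<close>

lemma rooted_at_if_tree_emb:
  "bst S \<Longrightarrow> tree_emb P S f \<Longrightarrow> (P \<noteq> Leaf \<Longrightarrow> S \<noteq> Leaf \<and> f (value P) = value S) \<Longrightarrow> rooted_at P S"
proof (induction P arbitrary: S)
  case (Node p x q)
  then obtain l y r where S: "S = Node l y r" "f x = y" by (cases S) auto
  have sub: "tree_emb p S f" "tree_emb q S f"
    using Node.prems(2) unfolding tree_emb_def by auto
  have l: "l \<in> subtrees S" "bst l" and r: "r \<in> subtrees S" "bst r"
    using S Node.prems(1) by (auto simp: self_in_subtrees)
  have ll: "l \<noteq> Leaf \<and> f (value p) = value l" if "p \<noteq> Leaf"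
  proof -
    have "lchild S (f (value p)) y" using Node.prems(2) that S(2) unfolding tree_emb_def by fastforce
    then show ?thesis using lchild_in[of l _ y] lchild_in[of r _ y] S Node.prems(1) by auto
  qed
  then have "tree_emb p l f"
    using tree_emb_restrict[OF Node.prems(1) l(1) sub(1)] by (simp add: value_in_set_tree)
  then have "rooted_at p l" using Node.IH(1) l ll by blast
  moreover have "\<exists>S'\<in>subtrees r. rooted_at q S'"
  proof (cases "q = Leaf")
    case False
    have "in_rsub S (f (value q)) y" using Node.prems(2) False S(2) unfolding tree_emb_def by fastforce
    then have qr: "f (value q) \<in> set_tree r"
      using in_rsub_in[of l _ y] in_rsub_in[of r _ y] S Node.prems(1) by auto
    obtain S' where S': "S' \<in> subtrees r" "S' \<noteq> Leaf" "value S' = f (value q)"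
      using subtree_at[OF qr] by auto
    then have "S' \<in> subtrees S" using S by auto
    then have "tree_emb q S' f"
      using tree_emb_restrict[OF Node.prems(1) _ sub(2)] S' by (metis value_in_set_tree)
    then have "rooted_at q S'" using Node.IH(2) S' r(2) bst_subtree by metis
    then show ?thesis using S' by blast
  qed (auto intro: Leaf_in_subtrees)
  ultimately show ?case using S by simp
qed simp

lemma occurs_in_if_tree_emb:
  assumes "bst T" "tree_emb P T f"
  shows "occurs_in P T"
proof (cases "P = Leaf")
  case True then show ?thesis unfolding occurs_in_def using Leaf_in_subtrees by auto
next
  case False
  then have PT: "f (value P) \<in> set_tree T" using assms(2) value_in_set_tree unfolding tree_emb_def by blast
  obtain S where S: "S \<in> subtrees T" "S \<noteq> Leaf" "value S = f (value P)"
    using subtree_at[OF PT] by auto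
  then have "tree_emb P S f" using tree_emb_restrict[OF assms(1) S(1) assms(2)] by (metis value_in_set_tree)
  then show ?thesis unfolding occurs_in_def
    using rooted_at_if_tree_emb S assms(1) bst_subtree by metis
qed

lemma emb_lift:
  assumes "bst T" "S \<in> subtrees T" 
  shows "tree_emb P S f \<Longrightarrow> tree_emb P T f" "word_emb P S f \<Longrightarrow> word_emb P T f"
  subgoal using set_subtree[OF assms(2)] lchild_subtree[OF assms(2)] in_rsub_subtree[OF assms(2)]
    unfolding tree_emb_def by blast
  subgoal using set_subtree[OF assms(2)] bmin_subtree[OF assms]
    unfolding word_emb_def by (auto simp: image_subset_iff)
  done

text \<open>Embeddings of the two subpatterns are glued at the root. Contiguity of left edges puts
  the root and its left child into one block on both sides, and right subtrees contain only later
  blocks; hence the same map also respects the words.\<close>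

lemma emb_if_rooted_at:
  "bst P \<Longrightarrow> bst T \<Longrightarrow> rooted_at P T \<Longrightarrow>
   \<exists>f. tree_emb P T f \<and> word_emb P T f \<and> (P \<noteq> Leaf \<longrightarrow> f (value P) = value T)"
proof (induction P arbitrary: T)
  case Leaf then show ?case by (auto simp: tree_emb_def word_emb_def strict_mono_on_def)
next
  case (Node p x q)
  obtain l y r S where T: "T = Node l y r" "rooted_at p l" "S \<in> subtrees r" "rooted_at q S"
    using Node.prems by (cases T) auto
  have b: "bst p" "bst q" "bst l" "bst r" "bst S" using Node.prems T bst_subtree by auto
  obtain g where g: "tree_emb p l g" "word_emb p l g" "p \<noteq> Leaf \<longrightarrow> g (value p) = value l"
    using Node.IH(1) b T by blast
  obtain h where h: "tree_emb q r h" "word_emb q r h"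
    using Node.IH(2) b T emb_lift by metis
  define f where "f i = (if i < x then g i else if i = x then y else h i)" for i
  have lt: "\<And>i. i \<in> set_tree p \<Longrightarrow> i < x" "\<And>i. i \<in> set_tree q \<Longrightarrow> x < i"
    "\<And>i. i \<in> set_tree l \<Longrightarrow> i < y" "\<And>i. i \<in> set_tree r \<Longrightarrow> y < i"
    using Node.prems T by auto
  have fp: "f i = g i" if "i \<in> set_tree p" for i using lt that unfolding f_def by auto
  have fx: "f x = y" by (simp add: f_def)
  have fq: "f i = h i" if "i \<in> set_tree q" for i using lt(2)[OF that] unfolding f_def by auto
  have gin: "g i \<in> set_tree l" if "i \<in> set_tree p" for i using g(1) that unfolding tree_emb_def by auto
  have hin: "h i \<in> set_tree r" if "i \<in> set_tree q" for i using h(1) that unfolding tree_emb_def by auto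
  have im: "f ` set_tree (Node p x q) \<subseteq> set_tree T"
    using fp fx fq gin hin T by auto
  have pl: "p \<noteq> Leaf \<Longrightarrow> l \<noteq> Leaf" using T(2) by (cases p; cases l) auto
  have "lchild T (f i) (f j)" if a: "lchild (Node p x q) i j" for i j
  proof -
    consider "j = x" "p \<noteq> Leaf" "i = value p" | "lchild p i j" | "lchild q i j" using a by auto
    then show ?thesis
    proof cases
      case 1 then show ?thesis using pl g(3) T fx fp by (simp add: value_in_set_tree)
    next
      case 2 then have "lchild l (g i) (g j)" using g(1) unfolding tree_emb_def by blast
      then show ?thesis using lchild_in[OF 2] fp T by simp
    next
      case 3 then have "lchild r (h i) (h j)" using h(1) unfolding tree_emb_def by blast
      then show ?thesis using lchild_in[OF 3] fq T by simp
    qed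
  qed
  moreover have "in_rsub T (f i) (f j)" if a: "rchild (Node p x q) i j" for i j
  proof -
    consider "j = x" "q \<noteq> Leaf" "i = value q" | "rchild p i j" | "rchild q i j" using a by auto
    then show ?thesis
    proof cases
      case 1 then show ?thesis using hin T fx fq by (simp add: value_in_set_tree)
    next
      case 2 then have "in_rsub l (g i) (g j)" using g(1) unfolding tree_emb_def by blast
      then show ?thesis using rchild_in[OF 2] fp T by simp
    next
      case 3 then have "in_rsub r (h i) (h j)" using h(1) unfolding tree_emb_def by blast
      then show ?thesis using rchild_in[OF 3] fq T by simp
    qed
  qed
  ultimately have te: "tree_emb (Node p x q) T f" using im unfolding tree_emb_def by blast
  have mg: "g i < g j" if "i \<in> set_tree p" "j \<in> set_tree p" "i < j" for i j
    using g(2) that unfolding word_emb_def by (auto dest: strict_mono_onD)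
  have mh: "h i < h j" if "i \<in> set_tree q" "j \<in> set_tree q" "i < j" for i j
    using h(2) that unfolding word_emb_def by (auto dest: strict_mono_onD)
  have glh: "g i < h j" if "i \<in> set_tree p" "j \<in> set_tree q" for i j
    using lt(3)[OF gin[OF that(1)]] lt(4)[OF hin[OF that(2)]] by simp
  have mono: "strict_mono_on (set_tree (Node p x q)) f"
  proof (rule strict_mono_onI)
    fix i j assume a: "i \<in> set_tree (Node p x q)" "j \<in> set_tree (Node p x q)" "i < j"
    consider "i \<in> set_tree p" "j \<in> set_tree p" | "i \<in> set_tree p" "j = x" 
      | "i \<in> set_tree p" "j \<in> set_tree q" | "i = x" "j \<in> set_tree q"
      | "i \<in> set_tree q" "j \<in> set_tree q"
      using a lt(1,2) by fastforce
    then show "f i < f j"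
      by cases (use a fp fq fx mg mh glh lt(3,4) gin hin in simp_all)
  qed
  have Pp: "bmin (Node p x q) i = bmin p i" if "i \<in> set_tree p" for i using lt(1)[OF that] by simp
  have Pq: "bmin (Node p x q) i = bmin q i" if "i \<in> set_tree q" for i using lt(2)[OF that] by simp
  have Tl: "bmin T i = bmin l i" if "i \<in> set_tree l" for i using lt(3)[OF that] T by simp
  have Tr: "bmin T i = bmin r i" if "i \<in> set_tree r" for i using lt(4)[OF that] T by simp
  have Px: "bmin (Node p x q) x = (if p = Leaf then x else bmin p (value p))" by simp
  have Ty: "bmin T y = (if l = Leaf then y else bmin l (value l))" using T by simp
  have Txl: "bmin T y \<le> y" using bmin_le[of T y] Node.prems T by simp
  have Pxl: "bmin (Node p x q) x \<le> x" using bmin_le[of "Node p x q" x] Node.prems by simp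
  have gg: "bmin l (g i) < bmin l (g j) \<longleftrightarrow> bmin p i < bmin p j"
    if "i \<in> set_tree p" "j \<in> set_tree p" for i j using g(2) that unfolding word_emb_def by blast
  have hh: "bmin r (h i) < bmin r (h j) \<longleftrightarrow> bmin q i < bmin q j"
    if "i \<in> set_tree q" "j \<in> set_tree q" for i j using h(2) that unfolding word_emb_def by blast
  have cmp: "bmin T (f i) < bmin T (f j) \<longleftrightarrow> bmin (Node p x q) i < bmin (Node p x q) j"
    if a: "i \<in> set_tree (Node p x q)" "j \<in> set_tree (Node p x q)" for i j
  proof -
    \<comment> \<open>Comparisons with the root reduce to comparisons with its left child, which
      shares its block.\<close>
    have px: "bmin T (f i) = bmin l (g (value p)) \<and> bmin (Node p x q) i = bmin p (value p)"
      if "p \<noteq> Leaf" "i = x" for i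
      using that fx Px Ty pl g(3) by simp
    have low: "bmin T (f i) < y \<and> bmin (Node p x q) i < x" if "i \<in> set_tree p" for i
      using bmin_in[OF b(1) that] bmin_in[OF b(3) gin[OF that]] fp that Pp Tl gin lt by simp
    have high: "y < bmin T (f i) \<and> x < bmin (Node p x q) i" if "i \<in> set_tree q" for i
      using bmin_in[OF b(2) that] bmin_in[OF b(4) hin[OF that]] fq that Pq Tr hin lt by simp
    consider "i \<in> set_tree p" "j \<in> set_tree p" | "i \<in> set_tree p" "j = x" 
      | "i \<in> set_tree p" "j \<in> set_tree q" | "i = x" "j \<in> set_tree q"
      | "i \<in> set_tree q" "j \<in> set_tree q" | "i = x" "j \<in> set_tree p" | "i = x" "j = x"
      | "i \<in> set_tree q" "j = x" | "i \<in> set_tree q" "j \<in> set_tree p"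
      using a by auto
    then show ?thesis
    proof cases
      case 1 then show ?thesis using fp gin Pp Tl gg by simp
    next
      case 2 then have "p \<noteq> Leaf" by auto
      then show ?thesis using 2 px[of x] fp gin Pp Tl gg[of i "value p"] by (simp add: value_in_set_tree)
    next
      case 3 then show ?thesis using low[of i] high[of j] by simp
    next
      case 4 then show ?thesis using high[of j] Txl Pxl fx by simp
    next
      case 5 then show ?thesis using fq hin Pq Tr hh by simp
    next
      case 6 then have "p \<noteq> Leaf" by auto
      then show ?thesis using 6 px[of x] fp gin Pp Tl gg[of "value p" j] by (simp add: value_in_set_tree)
    next
      case 7 then show ?thesis by simp
    next
      case 8 then show ?thesis using high[of i] Txl Pxl fx by simp
    next
      case 9 then show ?thesis using low[of j] high[of i] by simp
    qed
  qed
  show ?case using te im mono cmp fx T unfolding word_emb_def by (intro exI[of _ f]) auto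
qed

lemma emb_if_occurs_in:
  assumes "bst P" "bst T" "occurs_in P T"
  shows "\<exists>f. tree_emb P T f \<and> word_emb P T f"
  using assms emb_if_rooted_at emb_lift bst_subtree unfolding occurs_in_def by metis

text \<open>Injectivity is recovered by passing through an occurrence: the embedding rebuilt from it
  is strictly increasing.\<close>

lemma contains_pattern_iff_occurs_in:
  assumes "bst P" "bst T" "\<forall>i p. lchild P i p \<longrightarrow> e i" "\<forall>i p. rchild P i p \<longrightarrow> \<not> e i"
  shows "contains_pattern T P e \<longleftrightarrow> occurs_in P T"
proof -
  have "contains_pattern T P e \<longleftrightarrow> (\<exists>f. inj_on f (set_tree P) \<and> tree_emb P T f)"
    unfolding contains_pattern_def tree_emb_def using assms(3,4) by meson
  also have "\<dots> \<longleftrightarrow> occurs_in P T"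
    using occurs_in_if_tree_emb[OF assms(2)] emb_if_occurs_in[OF assms(1,2)]
    unfolding word_emb_def by (meson strict_mono_on_imp_inj_on)
  finally show ?thesis .
qed

section \<open>From embeddings of words to occurrences\<close>

fun left_path :: "nat tree \<Rightarrow> bool" where
  "left_path Leaf = True"
| "left_path (Node l x r) = (r = Leaf \<and> left_path l)"

text \<open>Staggered patterns in which every branch except possibly the first has its distinguished vertex
  strictly below its top, i.e. satisfies \<open>\<beta> < \<alpha>\<close>.\<close>

fun stag_shape :: "nat tree \<Rightarrow> bool" where
  "stag_shape Leaf = True"
| "stag_shape (Node l x r) =
     (if r = Leaf then stag_shape l else left_path l \<and> stag_shape r \<and> right r = Leaf)"

lemma left_path_stag_shape: "left_path P \<Longrightarrow> stag_shape P"
  by (induction P) auto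

text \<open>A left path only asks for enough vertices on the left branch of the host, and
  \<open>Node S y t\<close> offers one more than \<open>S\<close>.\<close>

lemma left_path_rooted_at_Node: "left_path p \<Longrightarrow> rooted_at p S \<Longrightarrow> rooted_at p (Node S y t)"
proof (induction p arbitrary: S y t)
  case (Node l x r)
  then obtain l' y' r' where S: "S = Node l' y' r'" "rooted_at l l'" by (cases S) auto
  then have "rooted_at l S" using Node by auto
  then show ?case using Node.prems Leaf_in_subtrees by auto
qed simp

lemma left_path_rooted_at_spine:
  "left_path p \<Longrightarrow> S \<in> set (spine T) \<Longrightarrow> rooted_at p S \<Longrightarrow> rooted_at p T"
proof (induction T)
  case (Node l x r)
  then show ?case using left_path_rooted_at_Node[of p l] by auto
qed simp

lemma spine_subset_subtrees: "S \<in> set (spine T) \<Longrightarrow> S \<in> subtrees T"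
  by (induction T) auto

text \<open>Supplies the vertex directly above \<open>S\<close> on the left branch, which will host
  the root of a pattern whose left subtree is placed at \<open>S\<close>.\<close>

lemma spine_left_extend:
  "S \<in> set (spine l) \<Longrightarrow> \<exists>z s. Node S z s \<in> set (spine (Node l y t))"
proof (induction l arbitrary: y t)
  case (Node l1 x l2)
  then consider "S = Node l1 x l2" | "S \<in> set (spine l1)" by auto
  then show ?case
  proof cases
    case 2 then show ?thesis using Node.IH(1)[of x l2] by auto
  qed auto
qed simp

section \<open>Where an embedding of words sends a subpattern\<close>

lemma word_emb_in: "word_emb P T f \<Longrightarrow> i \<in> set_tree P \<Longrightarrow> f i \<in> set_tree T"
  unfolding word_emb_def by auto

lemma word_emb_less: "word_emb P T f \<Longrightarrow> i \<in> set_tree P \<Longrightarrow> j \<in> set_tree P \<Longrightarrow> i < j \<Longrightarrow> f i < f j"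
  unfolding word_emb_def by (auto dest: strict_mono_onD)

lemma word_emb_le: "word_emb P T f \<Longrightarrow> i \<in> set_tree P \<Longrightarrow> j \<in> set_tree P \<Longrightarrow> i \<le> j \<Longrightarrow> f i \<le> f j"
  using word_emb_less le_less by metis

lemma word_emb_bmin_eq:
  "word_emb P T f \<Longrightarrow> i \<in> set_tree P \<Longrightarrow> j \<in> set_tree P \<Longrightarrow>
   bmin T (f i) = bmin T (f j) \<longleftrightarrow> bmin P i = bmin P j"
  unfolding word_emb_def by (metis less_irrefl linorder_neqE)

lemma word_emb_bmin_less:
  "word_emb P T f \<Longrightarrow> i \<in> set_tree P \<Longrightarrow> j \<in> set_tree P \<Longrightarrow>
   bmin T (f i) < bmin T (f j) \<longleftrightarrow> bmin P i < bmin P j"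
  unfolding word_emb_def by blast

text \<open>Block minima are local to subtrees, so the order conditions survive restriction on both
  sides.\<close>

lemma word_emb_restrict:
  assumes "bst P" "bst T" "Q \<in> subtrees P" "S \<in> subtrees T" "word_emb P T f"
    "f ` set_tree Q \<subseteq> set_tree S"
  shows "word_emb Q S f"
proof -
  have sub: "set_tree Q \<subseteq> set_tree P" using assms(3) set_subtree by blast
  have "strict_mono_on (set_tree Q) f"
    using assms(5) sub unfolding word_emb_def by (auto intro!: strict_mono_onI dest: strict_mono_onD)
  moreover have "bmin S (f i) < bmin S (f j) \<longleftrightarrow> bmin Q i < bmin Q j"
    if "i \<in> set_tree Q" "j \<in> set_tree Q" for i j
  proof -
    have "f i \<in> set_tree S" "f j \<in> set_tree S" using that assms(6) by auto
    then show ?thesis using that sub word_emb_bmin_less[OF assms(5), of i j]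
      bmin_subtree[OF assms(2,4)] bmin_subtree[OF assms(1,3)] by auto
  qed
  ultimately show ?thesis using assms(6) unfolding word_emb_def by blast
qed

lemma le_value_if_right_Leaf: "bst P \<Longrightarrow> right P = Leaf \<Longrightarrow> v \<in> set_tree P \<Longrightarrow> v \<le> value P"
  by (cases P) auto

text \<open>If the root of \<open>Q\<close> has no right child, then the first and the last vertex of \<open>Q\<close> lie on the same
  left branch, so the image of \<open>Q\<close> cannot be spread over both sides of the root of the host tree.\<close>

lemma word_emb_location:
  assumes "bst Q" "Q \<noteq> Leaf" "right Q = Leaf" "bst (Node l y t)" "word_emb Q (Node l y t) f"
  shows "f (value Q) \<in> set_tree l \<and> f ` set_tree Q \<subseteq> set_tree l
    \<or> f (value Q) \<in> set_tree t \<and> f ` set_tree Q \<subseteq> set_tree t \<or> f (value Q) = y"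
proof -
  let ?T = "Node l y t" and ?c = "f (value Q)" and ?m = "bmin Q (value Q)"
  have q: "value Q \<in> set_tree Q" "?m \<in> set_tree Q"
    using assms by (simp_all add: value_in_set_tree bmin_in)
  have im: "f i \<in> set_tree ?T" "f ?m \<le> f i" "f i \<le> ?c" if "i \<in> set_tree Q" for i
    using that word_emb_in word_emb_le assms q bmin_root_le le_value_if_right_Leaf by blast+
  have eq: "bmin ?T (f ?m) = bmin ?T ?c"
    using word_emb_bmin_eq[OF assms(5) q(2,1)] bmin_bmin_root assms by blast
  have c: "?c \<in> set_tree ?T" using im q by blast
  consider "?c \<in> set_tree l" | "?c \<in> set_tree t" | "?c = y" using c by auto
  then show ?thesis
  proof cases
    case 1
    then have "?c < y" using assms(4) by auto
    then have "f i \<in> set_tree l" if "i \<in> set_tree Q" for i using im[OF that] assms(4) by auto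
    then show ?thesis using 1 by auto
  next
    case 2
    \<comment> \<open>The block of \<open>?c\<close> lies entirely to the right of \<open>y\<close>
      and contains the image of the least vertex of \<open>Q\<close>, so no vertex of
      \<open>Q\<close> is sent to \<open>y\<close> or to its left.\<close>
    then have "bmin ?T ?c \<in> set_tree t" using assms(4) bmin_in[of t ?c] by auto
    then have "y < bmin ?T ?c" using assms(4) by auto
    then have "y < f ?m" using eq bmin_le[OF assms(4) im(1)[OF q(2)]] by simp
    then have "f i \<in> set_tree t" if "i \<in> set_tree Q" for i using im[OF that] assms(4) by auto
    then show ?thesis using 2 by auto
  qed simp
qed

lemma occurs_in_left: "occurs_in P l \<Longrightarrow> occurs_in P (Node l y t)"
  and occurs_in_right: "occurs_in P t \<Longrightarrow> occurs_in P (Node l y t)"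
  unfolding occurs_in_def by auto

text \<open>Descends to the place where \<open>P\<close> is split by the root of the host, which by
  \<open>word_emb_location\<close> means that \<open>value P\<close> is sent to that root. The
  rooted case is kept as the hypothesis \<open>H\<close> so that the descent can be used for the
  subpattern \<open>r\<close> during the induction that proves \<open>H\<close>, and for
  \<open>P\<close> afterwards.\<close>

lemma occurs_in_if_word_emb_closed_aux:
  assumes H: "\<And>f T. bst T \<Longrightarrow> word_emb P T f \<Longrightarrow> bmin T (f (value P)) = bmin T (value T) \<Longrightarrow>
      \<exists>S\<in>set (spine T). rooted_at P S"
    and P: "bst P" "P \<noteq> Leaf" "right P = Leaf"
  shows "bst T \<Longrightarrow> word_emb P T f \<Longrightarrow> occurs_in P T"
proof (induction T)
  case Leaf
  then show ?case using P word_emb_in[OF Leaf(2) value_in_set_tree] by simp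
next
  case (Node l y t)
  note re = word_emb_restrict[OF P(1) Node.prems(1) self_in_subtrees _ Node.prems(2)]
  consider "f ` set_tree P \<subseteq> set_tree l" | "f ` set_tree P \<subseteq> set_tree t" | "f (value P) = y"
    using word_emb_location[OF P Node.prems] by blast
  then show ?case
  proof cases
    case 1 then have "word_emb P l f" using re by (simp add: self_in_subtrees)
    then show ?thesis using Node occurs_in_left by auto
  next
    case 2 then have "word_emb P t f" using re by (simp add: self_in_subtrees)
    then show ?thesis using Node occurs_in_right by auto
  next
    case 3 then show ?thesis using H[OF Node.prems] spine_subset_subtrees unfolding occurs_in_def by fastforce
  qed
qed

text \<open>If the root of \<open>P\<close> is sent to the left branch of the root of
  \<open>T\<close>, an occurrence can be anchored on that same branch. This strengthening lets an
  occurrence of the left subpattern be prolonged by the next vertex upwards, which yields contiguous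
  edges.\<close>

lemma spine_occurrence_if_word_emb:
  "bst P \<Longrightarrow> stag_shape P \<Longrightarrow> P \<noteq> Leaf \<Longrightarrow> bst T \<Longrightarrow> word_emb P T f \<Longrightarrow>
   bmin T (f (value P)) = bmin T (value T) \<Longrightarrow> \<exists>S\<in>set (spine T). rooted_at P S"
proof (induction P arbitrary: f T)
  case (Node p x r)
  let ?P = "Node p x r"
  note IHr = Node.IH(2)
  have b: "bst p" "bst r" using Node.prems by auto
  have inP: "p \<in> subtrees ?P" "r \<in> subtrees ?P" by (auto simp: self_in_subtrees)
  have lt: "i < x" if "i \<in> set_tree p" for i using that Node.prems by auto
  have gt: "i > x" if "i \<in> set_tree r" for i using that Node.prems by auto
  \<comment> \<open>The left subpattern inherits the anchoring: \<open>value p\<close> shares its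
    block with \<open>x\<close>, and the left branch of \<open>l\<close> continues that of the
    host.\<close>
  have pp: "\<exists>S\<in>set (spine l). rooted_at p S"
    if a: "bst (Node l y t)" "word_emb ?P (Node l y t) f" "p \<noteq> Leaf" "stag_shape p"
      "f ` set_tree p \<subseteq> set_tree l" "bmin (Node l y t) (f x) = bmin (Node l y t) y" for l y t
  proof -
    have w: "word_emb p l f"
      using word_emb_restrict[OF Node.prems(1) a(1) inP(1) _ a(2,5)] by (simp add: self_in_subtrees)
    have vp: "value p \<in> set_tree p" using a(3) by (simp add: value_in_set_tree)
    then have vl: "f (value p) \<in> set_tree l" using a(5) by blast
    then have l: "l \<noteq> Leaf" by auto
    have "bmin ?P (value p) = bmin ?P x" using lt[OF vp] a(3) by simp
    then have "bmin (Node l y t) (f (value p)) = bmin (Node l y t) (f x)"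
      using word_emb_bmin_eq[OF a(2), of "value p" x] vp by simp
    then have "bmin l (f (value p)) = bmin l (value l)" using a(1,6) vl l by auto
    then show ?thesis using Node.IH(1)[OF b(1) a(4,3) _ w] a(1) by auto
  qed
  \<comment> \<open>An inner induction walks down the left branch of the host until its root can
    carry the image.\<close>
  from Node.prems(4-6) show ?case
  proof (induction T)
    case Leaf
    then show ?case using word_emb_in[OF Leaf(2), of x] by simp
  next
    case (Node l y t)
    note T = Node
    let ?T = "Node l y t"
    have bl: "bst l" "bst t" using T by auto
    have inT: "l \<in> subtrees ?T" "t \<in> subtrees ?T" by (auto simp: self_in_subtrees)
    note re = word_emb_restrict[OF \<open>bst ?P\<close> T(3) _ _ T(4)]
    have im: "f i \<in> set_tree ?T" if "i \<in> set_tree ?P" for i using word_emb_in[OF T(4) that] .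
    have fxt: "f x \<le> y"
    proof (rule ccontr)
      assume "\<not> f x \<le> y"
      then have "f x \<in> set_tree t" using im[of x] T(3) by auto
      then have "bmin ?T (f x) > y" using T(3) bmin_in[of t "f x"] by auto
      then show False using T(3,5) bmin_le[of ?T y] by simp
    qed
    have pim: "f i \<in> set_tree l" if "i \<in> set_tree p" for i
      using im[of i] word_emb_less[OF T(4), of i x] lt[OF that] that fxt T(3) by auto
    have left_case: ?case if fl: "f ` set_tree ?P \<subseteq> set_tree l"
    proof -
      have "word_emb ?P l f" using re[OF self_in_subtrees inT(1)] fl by blast
      moreover have "f x \<in> set_tree l" using fl by simp
      then have "bmin l (f x) = bmin l (value l)" using T(3,5) by auto
      ultimately show ?thesis using T(1) bl(1) by auto
    qed
    show ?case
    proof (cases "r = Leaf")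
      case r: True
      then have sp: "stag_shape p" using Node.prems \<open>stag_shape ?P\<close> by simp
      show ?thesis
      proof (cases "f x = y")
        case True
        show ?thesis
        proof (cases "p = Leaf")
          case True then show ?thesis using r Leaf_in_subtrees by auto
        next
          case False
          then obtain S where S: "S \<in> set (spine l)" "rooted_at p S"
            using pp[OF T(3,4) False sp] pim T(5) by auto
          \<comment> \<open>The root \<open>x\<close> is hosted directly above \<open>S\<close>,
            possibly below its image \<open>y\<close>, to make the edge to the left subpattern
            contiguous.\<close>
          then obtain z s where "Node S z s \<in> set (spine ?T)"
            using spine_left_extend[OF S(1)] by meson
          moreover have "rooted_at ?P (Node S z s)" using r S Leaf_in_subtrees by auto
          ultimately show ?thesis by blast
        qed
      next
        case False
        then have "f x \<in> set_tree l" using im[of x] fxt T(3) by auto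
        then show ?thesis using left_case pim r by auto
      qed
    next
      case r: False
      then have lp: "left_path p" and sr: "stag_shape r" "right r = Leaf"
        using \<open>stag_shape ?P\<close> by auto
      have vr: "value r \<in> set_tree r" using r by (simp add: value_in_set_tree)
      have wr: "word_emb r ?T f" using re[OF inP(2) self_in_subtrees] im by auto
      \<comment> \<open>The block of \<open>value r\<close> comes strictly after that of
        \<open>x\<close>, whereas \<open>y\<close> is in the block of \<open>f x\<close>; so
        \<open>value r\<close> is not sent to \<open>y\<close>.\<close>
      have "bmin ?P x \<le> x" using bmin_le[OF \<open>bst ?P\<close>, of x] by simp
      moreover have "x < bmin ?P (value r)" using gt[OF vr] gt[OF bmin_in[OF b(2) vr]] by simp
      ultimately have "bmin ?T (f x) < bmin ?T (f (value r))"
        using word_emb_bmin_less[OF T(4), of x "value r"] vr by simp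
      then have "f (value r) \<noteq> y" using T(5) by auto
      then consider "f (value r) \<in> set_tree l" "f ` set_tree r \<subseteq> set_tree l"
        | "f ` set_tree r \<subseteq> set_tree t"
        using word_emb_location[OF b(2) r sr(2) T(3) wr] by blast
      then show ?thesis
      proof cases
        case 1
        have "f x < f (value r)" using word_emb_less[OF T(4), of x "value r"] gt vr by simp
        also have "f (value r) < y" using 1 T(3) by auto
        finally have "f x \<in> set_tree l" using im[of x] T(3) by auto
        then show ?thesis using left_case pim 1 by auto
      next
        case 2
        \<comment> \<open>Now \<open>y\<close> can host the distinguished vertex even if
          \<open>f x\<close> lies lower on the branch: \<open>r\<close> occurs to the right of
          \<open>y\<close>, and the left path \<open>p\<close> fits at the top of \<open>l\<close>
          as soon as it fits anywhere on its spine.\<close>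
        then have "word_emb r t f" using re[OF inP(2) inT(2)] by blast
        then have "occurs_in r t"
          using occurs_in_if_word_emb_closed_aux[OF _ b(2) r sr(2) bl(2), of f]
            IHr[OF b(2) sr(1) r] by blast
        moreover have "rooted_at p l"
        proof (cases "p = Leaf")
          case False
          then obtain S where S: "S \<in> set (spine l)" "rooted_at p S"
            using pp[OF T(3,4) False left_path_stag_shape[OF lp]] pim T(5) by auto
          then show ?thesis using left_path_rooted_at_spine lp by blast
        qed simp
        ultimately show ?thesis unfolding occurs_in_def by auto
      qed
    qed
  qed
qed simp

lemma occurs_in_if_word_emb_closed:
  assumes "bst P" "stag_shape P" "P \<noteq> Leaf" "right P = Leaf" "bst T" "word_emb P T f"
  shows "occurs_in P T"
  by (rule occurs_in_if_word_emb_closed_aux[OF _ assms(1,3-6)])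
    (rule spine_occurrence_if_word_emb[OF assms(1-3)])

text \<open>This is where \<open>\<alpha>\<^sub>1 \<le> 2\<close> is needed: a root without left child that carries the image of \<open>r\<close> in
  its right subtree can be skipped, because the two-element branch of \<open>P\<close> then also lies there.\<close>

lemma occurs_in_if_word_emb_open:
  assumes P: "bst P" "P = Node p x r" and r: "stag_shape r" "r \<noteq> Leaf" "right r = Leaf"
    and p: "size p \<le> 1"
  shows "bst T \<Longrightarrow> word_emb P T f \<Longrightarrow> occurs_in P T"
proof (induction T)
  case Leaf
  then show ?case using P word_emb_in[OF Leaf(2), of x] by simp
next
  case (Node l y t)
  let ?T = "Node l y t"
  note re = word_emb_restrict[OF P(1) Node.prems(1) _ _ Node.prems(2)]
  have b: "bst r" "bst l" "bst t" using P Node.prems by auto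
  have inP: "r \<in> subtrees P" using P by (auto simp: self_in_subtrees)
  have inT: "l \<in> subtrees ?T" "t \<in> subtrees ?T" by (auto simp: self_in_subtrees)
  have vr: "value r \<in> set_tree r" using r by (simp add: value_in_set_tree)
  have gt: "i > x" if "i \<in> set_tree r" for i using that P by auto
  have lt: "i < x" if "i \<in> set_tree p" for i using that P by auto
  have im: "f i \<in> set_tree ?T" if "i \<in> set_tree P" for i using word_emb_in[OF Node.prems(2) that] .
  have wr: "word_emb r ?T f" using re[OF inP self_in_subtrees] im P by auto
  have "bmin P x \<le> x" using bmin_le[OF P(1), of x] P by simp
  moreover have "x < bmin P (value r)" using gt[OF vr] gt[OF bmin_in[OF b(1) vr]] P by simp
  ultimately have "bmin ?T (f x) < bmin ?T (f (value r))"
    using word_emb_bmin_less[OF Node.prems(2), of x "value r"] vr P by simp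
  moreover have "bmin ?T y \<le> bmin ?T (f x)"
    using bmin_root_le_bmin[OF Node.prems(1) im[of x]] P by simp
  ultimately have "f (value r) \<noteq> y" by auto
  then consider "f (value r) \<in> set_tree l" "f ` set_tree r \<subseteq> set_tree l"
    | "f ` set_tree r \<subseteq> set_tree t"
    using word_emb_location[OF b(1) r(2,3) Node.prems(1) wr] by blast
  then show ?case
  proof cases
    case 1
    have fr: "f (value r) < y" using 1 Node.prems(1) by auto
    \<comment> \<open>Vertices outside \<open>r\<close> precede \<open>value r\<close>, so their
      images precede a vertex of \<open>l\<close>.\<close>
    have "f i \<in> set_tree l" if i: "i \<in> set_tree P" for i
    proof (cases "i \<in> set_tree r")
      case False
      then have "i < value r" using i P lt gt[OF vr] by fastforce
      then have "f i < f (value r)" using word_emb_less[OF Node.prems(2), of i "value r"] i vr P by auto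
      then show ?thesis using fr im[OF i] Node.prems(1) by auto
    qed (use 1 in auto)
    then have "word_emb P l f" using re[OF self_in_subtrees inT(1)] by blast
    then show ?thesis using Node.IH b occurs_in_left by blast
  next
    case 2
    then have "word_emb r t f" using re[OF inP inT(2)] by blast
    then have rt: "occurs_in r t" using occurs_in_if_word_emb_closed b r by blast
    show ?thesis
    proof (cases "p = Leaf \<or> l \<noteq> Leaf")
      case True
      have "rooted_at p l"
      proof (cases p)
        case (Node p1 z p2)
        then have "p1 = Leaf" "p2 = Leaf" using p by auto
        then show ?thesis using Node True Leaf_in_subtrees by (cases l) auto
      qed simp
      then show ?thesis using rt P unfolding occurs_in_def by auto
    next
      case False
      then obtain z where z: "p = Node Leaf z Leaf" and l: "l = Leaf" using p by (cases p) auto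
      have "z < x" using P z by auto
      then have fz: "f z < f x" using word_emb_less[OF Node.prems(2), of z x] P z by auto
      have "bmin P z = bmin P x" using P z \<open>z < x\<close> by simp
      then have eq: "bmin ?T (f z) = bmin ?T (f x)"
        using word_emb_bmin_eq[OF Node.prems(2), of z x] P z by simp
      have ge: "y \<le> f z" using im[of z] P z l Node.prems(1) by auto
      then have xt: "f x \<in> set_tree t" using im[of x] fz P l by auto
      then have "bmin ?T (f x) > y" using bmin_in[OF b(3) xt] Node.prems(1) by auto
      \<comment> \<open>With \<open>l\<close> empty, \<open>y\<close> is alone in its block, but
        \<open>z\<close> and \<open>x\<close> share one.\<close>
      then have "f z \<noteq> y" using eq l by auto
      then have "f z \<in> set_tree t" using im[of z] P z l by auto
      then have "f ` set_tree P \<subseteq> set_tree t" using xt 2 P z by auto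
      then have "word_emb P t f" using re[OF self_in_subtrees inT(2)] by blast
      then show ?thesis using Node.IH b occurs_in_right by blast
    qed
  qed
qed

lemma occurs_in_iff_word_emb:
  assumes "bst P" "stag_shape P" "P \<noteq> Leaf" "right P \<noteq> Leaf \<longrightarrow> size (left P) \<le> 1" "bst T"
  shows "occurs_in P T \<longleftrightarrow> (\<exists>f. word_emb P T f)"
proof
  assume "\<exists>f. word_emb P T f"
  then obtain f where f: "word_emb P T f" ..
  show "occurs_in P T"
  proof (cases "right P = Leaf")
    case True then show ?thesis using assms f occurs_in_if_word_emb_closed by blast
  next
    case False
    obtain p x r where "P = Node p x r" using assms(3) by (cases P) auto
    then show ?thesis using assms f False occurs_in_if_word_emb_open[OF assms(1), of p x r T f] by simp
  qed
qed (use assms emb_if_occurs_in in blast)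

section \<open>From signatures to the shape of the pattern\<close>

lemma lchild_spine:
  "lchild P i p \<Longrightarrow> (\<exists>s\<in>set (tl (spine P)). i = value s) \<or> (\<exists>s\<in>set (spine P). lchild (right s) i p)"
proof (induction P)
  case (Node l x r)
  have "l \<noteq> Leaf \<Longrightarrow> l \<in> set (spine l)" by (cases l) auto
  moreover have "set (tl (spine l)) \<subseteq> set (spine l)" by (cases l) auto
  ultimately show ?case using Node by auto
qed simp

lemma rchild_spine:
  "rchild P i p \<Longrightarrow> \<exists>s\<in>set (spine P). right s \<noteq> Leaf \<and> i = value (right s) \<or> rchild (right s) i p"
  by (induction P) auto

lemma stag_contiguous_left: "stag e P as bs \<Longrightarrow> lchild P i p \<Longrightarrow> e i"
proof (induction rule: stag.induct)
  case (leftpath t)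
  then show ?case using lchild_spine[of t i p] by auto
next
  case (step t q as bs)
  show ?case using lchild_spine[OF step.prems]
  proof
    assume "\<exists>s\<in>set (spine t). lchild (right s) i p"
    then obtain m where m: "m < length (spine t)" "lchild (right (spine t ! m)) i p"
      by (auto simp: in_set_conv_nth)
    then have "m = q" using step by fastforce
    then show ?thesis using step m by simp
  qed (use step in auto)
qed

lemma stag_noncontiguous_right: "stag e P as bs \<Longrightarrow> rchild P i p \<Longrightarrow> \<not> e i"
proof (induction rule: stag.induct)
  case (leftpath t)
  then show ?case using rchild_spine[of t i p] by auto
next
  case (step t q as bs)
  obtain m where m: "m < length (spine t)" "right (spine t ! m) \<noteq> Leaf \<and> i = value (right (spine t ! m)) \<or> rchild (right (spine t ! m)) i p"
    using rchild_spine[OF step.prems] by (auto simp: in_set_conv_nth)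
  then have "m = q" using step by fastforce
  then show ?case using step m by auto
qed

lemma left_path_iff_spine: "left_path P \<longleftrightarrow> (\<forall>s\<in>set (spine P). right s = Leaf)"
  by (induction P) auto

text \<open>Turns positions on the branch, counted from the top, into the recursion of
  \<open>stag_shape\<close>: at position 0 the rest of the branch is a left path, otherwise the root
  has no right child and is peeled off.\<close>

lemma stag_shape_if_spine:
  "q < length (spine P) \<Longrightarrow> right (spine P ! q) \<noteq> Leaf \<Longrightarrow>
   \<forall>m<length (spine P). m \<noteq> q \<longrightarrow> right (spine P ! m) = Leaf \<Longrightarrow>
   stag_shape (right (spine P ! q)) \<Longrightarrow> right (right (spine P ! q)) = Leaf \<Longrightarrow> stag_shape P"
proof (induction P arbitrary: q)
  case (Node l x r)
  show ?case
  proof (cases q)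
    case 0
    have "right s = Leaf" if s: "s \<in> set (spine l)" for s
    proof -
      obtain m where "m < length (spine l)" "s = spine l ! m" using s by (auto simp: in_set_conv_nth)
      then show ?thesis using Node.prems(3)[rule_format, of "Suc m"] 0 by simp
    qed
    then have "left_path l" by (simp add: left_path_iff_spine)
    then show ?thesis using Node.prems 0 by simp
  next
    case (Suc q')
    have "r = Leaf" using Node.prems(3)[rule_format, of 0] Suc by simp
    moreover have "stag_shape l"
      using Node.prems Suc by (intro Node.IH(1)[of q']) force+
    ultimately show ?thesis by simp
  qed
qed simp

lemma right_eq_right_hd_spine: "P \<noteq> Leaf \<Longrightarrow> right P = right (spine P ! 0)"
  by (cases P) auto

lemma stag_nonempty: "stag e P as bs \<Longrightarrow> P \<noteq> Leaf \<and> as \<noteq> []"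
  by (induction rule: stag.induct) auto

text \<open>Since \<beta> counts from the bottom, \<beta> < \<alpha> says that the distinguished
  vertex is not the top of its branch, so that the root of the subpattern has no right
  child.\<close>

lemma stag_closed_shape:
  "stag e P as bs \<Longrightarrow> \<forall>i<length as - 1. bs ! i < as ! i \<Longrightarrow> stag_shape P \<and> right P = Leaf"
proof (induction rule: stag.induct)
  case (leftpath t)
  then show ?case using left_path_iff_spine left_path_stag_shape right_eq_right_hd_spine
    by (metis length_greater_0_conv nth_mem spine.elims list.distinct(1))
next
  case (step t q as bs)
  have ne: "as \<noteq> []" using stag_nonempty step by blast
  have "\<forall>i<length as - 1. bs ! i < as ! i"
    using step.prems[rule_format, of "Suc _"] by auto
  then have "stag_shape (right (spine t ! q)) \<and> right (right (spine t ! q)) = Leaf" using step.IH by blast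
  moreover have "q \<noteq> 0" using step.prems[rule_format, of 0] ne by auto
  ultimately show ?case using step stag_shape_if_spine right_eq_right_hd_spine[of t]
    by (metis length_pos_if_in_set nth_mem)
qed

lemma stag_shape_if_stag:
  assumes "stag e P as bs" "length as > 1 \<and> bs ! 0 = as ! 0 \<longrightarrow> as ! 0 \<in> {1, 2}"
    "\<forall>i. 2 \<le> i \<and> i \<le> length as - 1 \<longrightarrow> bs ! (i - 1) < as ! (i - 1)"
  shows "stag_shape P \<and> (right P \<noteq> Leaf \<longrightarrow> size (left P) \<le> 1)"
  using assms
proof (cases rule: stag.cases)
  case leftpath
  then show ?thesis using stag_closed_shape[OF assms(1)] by auto
next
  case (step q as' bs')
  have ne: "as' \<noteq> []" using stag_nonempty step by blast
  \<comment> \<open>The condition starts at the second branch, which has index 0 in the tail of the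
    signature; together with counting from one this is a shift by two.\<close>
  have "bs' ! i < as' ! i" if "i < length as' - 1" for i
    using assms(3)[rule_format, of "Suc (Suc i)"] that step(1,2) by simp
  then have r: "stag_shape (right (spine P ! q))" "right (right (spine P ! q)) = Leaf"
    using stag_closed_shape step by blast+
  then have sh: "stag_shape P" using stag_shape_if_spine step by blast
  have "size (left P) \<le> 1" if ri: "right P \<noteq> Leaf"
  proof -
    obtain l x t where P: "P = Node l x t" using step by (cases P) auto
    \<comment> \<open>A right child at the root means
      \<open>\<beta>\<^sub>1 = \<alpha>\<^sub>1\<close>, so the first branch has at most one vertex
      below the root.\<close>
    have "q = 0" using ri step(7) P by fastforce
    then have "length (spine P) \<le> 2" using assms(2) ne step(1,2) by auto
    then have "length (spine l) \<le> 1" using P by simp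
    moreover have "left_path l" using sh P ri by simp
    ultimately show ?thesis using P by (cases l; cases "left l") auto
  qed
  then show ?thesis using sh by blast
qed

section \<open>Trees and noncrossing partitions\<close>

lemma bmin_gt_value: "bst T \<Longrightarrow> w \<in> set_tree T \<Longrightarrow> value T < w \<Longrightarrow> value T < bmin T w"
  using bmin_in[of "right T" w] by (cases T) auto

lemma le_value_if_bmin_eq:
  "bst T \<Longrightarrow> w \<in> set_tree T \<Longrightarrow> bmin T w = bmin T (value T) \<Longrightarrow> w \<le> value T"
proof (rule ccontr)
  assume a: "bst T" "w \<in> set_tree T" "bmin T w = bmin T (value T)" "\<not> w \<le> value T"
  moreover have "T \<noteq> Leaf" using a by auto
  ultimately show False using bmin_gt_value[of T w] bmin_le[of T "value T"] value_in_set_tree by fastforce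
qed

lemma in_left_if_less: "bst (Node l x r) \<Longrightarrow> v \<in> set_tree (Node l x r) \<Longrightarrow> v < x \<Longrightarrow> v \<in> set_tree l"
  by auto

lemma in_right_if_greater: "bst (Node l x r) \<Longrightarrow> v \<in> set_tree (Node l x r) \<Longrightarrow> x < v \<Longrightarrow> v \<in> set_tree r"
  by auto

lemma bmin_left: "bst (Node l x r) \<Longrightarrow> v \<in> set_tree l \<Longrightarrow> bmin (Node l x r) v = bmin l v"
  and bmin_right: "bst (Node l x r) \<Longrightarrow> v \<in> set_tree r \<Longrightarrow> bmin (Node l x r) v = bmin r v"
  using bmin_subtree[of "Node l x r" l v] bmin_subtree[of "Node l x r" r v] self_in_subtrees by auto

text \<open>Four vertices on one side of the root are handled by induction. If \<open>d\<close> lies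
  to the right of the root and \<open>a\<close> does not, the block of \<open>d\<close> forces
  \<open>b\<close> and hence \<open>c\<close> to the right, and the block of \<open>c\<close> then
  excludes \<open>a\<close>. If \<open>d\<close> is the root, its left child represents the same
  block inside \<open>l\<close>.\<close>

lemma bmin_noncrossing:
  "bst T \<Longrightarrow> {a, b, c, d} \<subseteq> set_tree T \<Longrightarrow> a < b \<Longrightarrow> b < c \<Longrightarrow> c < d \<Longrightarrow>
   bmin T a = bmin T c \<Longrightarrow> bmin T b = bmin T d \<Longrightarrow> bmin T a = bmin T b"
proof (induction T arbitrary: a b c d)
  case (Node l x r)
  let ?T = "Node l x r"
  have b: "bst l" "bst r" using Node.prems by auto
  consider "d < x" | "x < a" | "a \<le> x" "x < d" | "d = x" by linarith
  then show ?case
  proof cases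
    case 1
    then have "{a, b, c, d} \<subseteq> set_tree l"
      using in_left_if_less[OF Node.prems(1)] Node.prems(2-5) by (meson insert_subset empty_subsetI less_trans)
    then show ?thesis
      using Node.IH(1)[OF b(1), of a b c d] Node.prems(3-7) bmin_left[OF Node.prems(1)] by simp
  next
    case 2
    then have "{a, b, c, d} \<subseteq> set_tree r"
      using in_right_if_greater[OF Node.prems(1)] Node.prems(2-5) by (meson insert_subset empty_subsetI less_trans)
    then show ?thesis
      using Node.IH(2)[OF b(2), of a b c d] Node.prems(3-7) bmin_right[OF Node.prems(1)]
      by (simp del: bmin.simps)
  next
    case 3
    then have "x < bmin ?T d" using bmin_gt_value[of ?T d] Node.prems by simp
    then have "x < b" using bmin_le[of ?T b] Node.prems by simp
    then have "x < bmin ?T c" using bmin_gt_value[of ?T c] Node.prems by simp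
    then show ?thesis using bmin_le[of ?T a] Node.prems 3 by simp
  next
    case 4
    then have s: "{a, b, c} \<subseteq> set_tree l"
      using in_left_if_less[OF Node.prems(1)] Node.prems(2-5) by (meson insert_subset empty_subsetI less_trans)
    then have l: "l \<noteq> Leaf" by auto
    have bd: "bmin l b = bmin l (value l)" using 4 Node.prems l by simp
    have ac: "bmin l a = bmin l c" using 4 Node.prems by simp
    have "b \<le> value l" using le_value_if_bmin_eq[OF b(1) _ bd] s by simp
    have "c \<le> value l"
    proof (rule ccontr)
      assume "\<not> c \<le> value l"
      then have "value l < bmin l c" using bmin_gt_value[of l c] b s by simp
      then show False using bmin_le[of l a] b s ac \<open>b \<le> value l\<close> \<open>a < b\<close> by simp
    qed
    \<comment> \<open>Here \<open>value l\<close> takes the place of \<open>d\<close>; if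
      \<open>c\<close> already equals it, the two blocks coincide.\<close>
    then have "bmin l a = bmin l b"
      using Node.IH(1)[of a b c "value l"] Node.prems b s bd ac l value_in_set_tree
      by (cases "c = value l") auto
    then show ?thesis using 4 Node.prems by simp
  qed
qed simp

text \<open>The root is the largest vertex in the block of the least vertex, so block minima
  determine it, and the inorder list then splits in only one way.\<close>

lemma eq_if_bmin_eq:
  "bst T \<Longrightarrow> inorder T = inorder T' \<Longrightarrow> \<forall>v\<in>set_tree T. bmin T v = bmin T' v \<Longrightarrow> T = T'"
proof (induction T arbitrary: T')
  case Leaf then show ?case by (cases T') auto
next
  case (Node l x r)
  let ?T = "Node l x r"
  obtain l' x' r' where T': "T' = Node l' x' r'" using Node.prems by (cases T') auto
  have b': "bst T'" using Node.prems(1,2) unfolding bst_iff_sorted_wrt_less by metis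
  have s: "set_tree ?T = set_tree T'" using Node.prems set_inorder by metis
  have x: "x \<in> set_tree T'" "x' \<in> set_tree ?T" using s T' by auto
  have val: "value ?T = x" "value T' = x'" using T' by simp_all
  have "x \<in> set_tree ?T" by simp
  then have in1: "bmin ?T x \<in> set_tree T'" using bmin_in[OF Node.prems(1)] unfolding s by blast
  have "x' \<in> set_tree T'" using T' by simp
  then have in2: "bmin T' x' \<in> set_tree ?T" using bmin_in[OF b'] unfolding s by blast
  \<comment> \<open>Both sides are the least vertex of the common vertex set.\<close>
  have e: "bmin ?T x = bmin T' x'"
    using bmin_root_le[OF Node.prems(1) in2] bmin_root_le[OF b' in1] unfolding val by (rule antisym)
  have "bmin T' x = bmin ?T x" using Node.prems(3) by (metis \<open>x \<in> set_tree ?T\<close>)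
  then have "x \<le> x'" using le_value_if_bmin_eq[OF b' x(1)] unfolding val e by blast
  moreover have "bmin ?T x' = bmin T' x'" using Node.prems(3) x(2) by metis
  then have "x' \<le> x" using le_value_if_bmin_eq[OF Node.prems(1) x(2)] unfolding val e by blast
  ultimately have xx: "x' = x" by simp
  have "inorder l @ x # inorder r = inorder l' @ x # inorder r'" using Node.prems(2) T' xx by simp
  moreover have "x \<notin> set (inorder l)" "x \<notin> set (inorder r)" using Node.prems(1) by auto
  ultimately have io: "inorder l = inorder l'" "inorder r = inorder r'"
    by (simp_all add: append_Cons_eq_iff)
  have sub: "set_tree l = set_tree l'" "set_tree r = set_tree r'" using io set_inorder by metis+
  have bT': "bst (Node l' x' r')" using b' T' by simp
  have agree: "bmin ?T v = bmin (Node l' x' r') v" if "v \<in> set_tree ?T" for v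
    using Node.prems(3) that T' by blast
  have "bmin l v = bmin l' v" if "v \<in> set_tree l" for v
    using agree[of v] bmin_left[OF Node.prems(1) that] bmin_left[OF bT', of v] that sub
    by (simp del: bmin.simps)
  moreover have "bmin r v = bmin r' v" if "v \<in> set_tree r" for v
    using agree[of v] bmin_right[OF Node.prems(1) that] bmin_right[OF bT', of v] that sub
    by (simp del: bmin.simps)
  ultimately have "l = l'" "r = r'" using Node.IH io Node.prems(1) by simp_all
  then show ?case using T' xx by simp
qed

section \<open>Left blocks as classes of equal block minimum\<close>

lemma lchild_bmin: "bst T \<Longrightarrow> lchild T u v \<Longrightarrow> bmin T u = bmin T v \<and> u < v"
proof (induction T)
  case (Node l x r)
  consider "v = x" "l \<noteq> Leaf" "u = value l" | "lchild l u v" | "lchild r u v" using Node.prems by auto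
  then show ?case
  proof cases
    case 1
    then have "u < x" using Node.prems value_in_set_tree[of l] by auto
    then show ?thesis using 1 by simp
  next
    case 2 then show ?thesis using Node lchild_in[OF 2] by auto
  next
    case 3
    then have "x < u" "x < v" using Node lchild_in[OF 3] by auto
    then show ?thesis using 3 Node by auto
  qed
qed simp

abbreviation lchain :: "nat tree \<Rightarrow> nat \<Rightarrow> nat \<Rightarrow> bool" where
  "lchain T \<equiv> (\<lambda>a b. lchild T b a)\<^sup>*\<^sup>*"

lemma lchain_subtree: "S \<in> subtrees T \<Longrightarrow> lchain S v w \<Longrightarrow> lchain T v w"
  using lchild_subtree rtranclp_mono[of "\<lambda>a b. lchild S b a" "\<lambda>a b. lchild T b a"] by blast

lemma lchain_root: "bst T \<Longrightarrow> w \<in> set_tree T \<Longrightarrow> bmin T w = bmin T (value T) \<Longrightarrow> lchain T (value T) w"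
proof (induction T)
  case (Node l x r)
  have "w \<le> x" using le_value_if_bmin_eq[OF Node.prems] by simp
  then consider "w = x" | "w \<in> set_tree l" "w < x" using Node.prems(1,2) by auto
  then show ?case
  proof cases
    case 2
    then have l: "l \<noteq> Leaf" by auto
    then have "bmin l w = bmin l (value l)" using Node.prems(3) 2 by simp
    then have "lchain l (value l) w" using Node.IH(1) Node.prems(1) 2 by simp
    then have "lchain (Node l x r) (value l) w" using lchain_subtree[of l "Node l x r"] 
      by (simp add: self_in_subtrees)
    moreover have "lchild (Node l x r) (value l) x" using l by simp
    ultimately have "lchain (Node l x r) x w" by (rule converse_rtranclp_into_rtranclp[rotated])
    then show ?thesis by simp
  qed simp
qed simp

text \<open>A block does not meet both the right subtree and the rest of the tree, so the descent
  continues until the larger vertex \<open>v\<close> is the root, where \<open>lchain_root\<close>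
  applies.\<close>

lemma lchain_if_bmin_eq:
  "bst T \<Longrightarrow> v \<in> set_tree T \<Longrightarrow> w \<in> set_tree T \<Longrightarrow> bmin T v = bmin T w \<Longrightarrow> w \<le> v \<Longrightarrow> lchain T v w"
proof (induction T)
  case (Node l x r)
  let ?T = "Node l x r"
  consider "v < x" | "v = x" | "x < w" | "x < v" "w \<le> x" by linarith
  then show ?case
  proof cases
    case 1
    then have "w < x" using Node.prems by simp
    then have "v \<in> set_tree l" "w \<in> set_tree l" using Node.prems 1 by auto
    then have "lchain l v w" using Node.IH(1) Node.prems 1 by simp
    then show ?thesis using lchain_subtree[of l ?T] by (simp add: self_in_subtrees)
  next
    case 2
    then show ?thesis using lchain_root[OF Node.prems(1,3)] Node.prems(4) by simp
  next
    case 3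
    then have "x < v" using Node.prems by simp
    then have "v \<in> set_tree r" "w \<in> set_tree r" using Node.prems 3 by auto
    then have "lchain r v w" using Node.IH(2) Node.prems 3 by simp
    then show ?thesis using lchain_subtree[of r ?T] by (simp add: self_in_subtrees)
  next
    case 4
    then show ?thesis using bmin_gt_value[of ?T v] bmin_le[of ?T w] Node.prems by simp
  qed
qed simp

lemma lchain_bmin: "lchain T v w \<Longrightarrow> bst T \<Longrightarrow> v \<in> set_tree T \<Longrightarrow>
   w \<in> set_tree T \<and> bmin T w = bmin T v \<and> w \<le> v"
proof (induction rule: rtranclp_induct)
  case (step y z)
  then show ?case using lchild_in[of T z y] lchild_bmin[of T z y] by auto
qed simp

definition bclass :: "nat tree \<Rightarrow> nat \<Rightarrow> nat set" where
  "bclass T v = {w \<in> set_tree T. bmin T w = bmin T v}"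

lemma left_blocks_eq:
  assumes "bst T"
  shows "left_blocks T = bclass T ` set_tree T"
proof -
  have fin: "finite (bclass T v)" for v unfolding bclass_def by simp
  \<comment> \<open>The maximum of a class is the top of its branch: the parent of a left child
    would be a larger member of the class.\<close>
  have top: "{w. lchain T (Max (bclass T v)) w} = bclass T v \<and> Max (bclass T v) \<in> bclass T v
      \<and> \<not> (\<exists>u. lchild T (Max (bclass T v)) u)" if v: "v \<in> set_tree T" for v
  proof -
    let ?u = "Max (bclass T v)"
    have "v \<in> bclass T v" using v by (simp add: bclass_def)
    then have u: "?u \<in> bclass T v" using fin Max_in by blast
    then have ut: "?u \<in> set_tree T" "bmin T ?u = bmin T v" by (auto simp: bclass_def)
    have "{w. lchain T ?u w} = bclass T v"
    proof (intro set_eqI iffI)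
      fix w assume "w \<in> {w. lchain T ?u w}"
      then show "w \<in> bclass T v" using lchain_bmin[of T ?u w] assms ut by (auto simp: bclass_def)
    next
      fix w assume w: "w \<in> bclass T v"
      then have "w \<le> ?u" using fin by simp
      then show "w \<in> {w. lchain T ?u w}"
        using lchain_if_bmin_eq[OF assms ut(1), of w] w ut by (auto simp: bclass_def)
    qed
    moreover have "\<not> lchild T ?u u" for u
    proof
      assume a: "lchild T ?u u"
      then have "u \<in> bclass T v" "?u < u"
        using lchild_in[OF a] lchild_bmin[OF assms a] ut by (auto simp: bclass_def)
      then show False using fin Max_ge leD by blast
    qed
    ultimately show ?thesis using u by blast
  qed
  \<comment> \<open>Conversely, a vertex that is no left child can be reached by left steps only
    from itself.\<close>
  have topeq: "v = Max (bclass T v)" if v: "v \<in> set_tree T" "\<not> (\<exists>u. lchild T v u)" for v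
  proof -
    have "v \<in> bclass T v" using v by (simp add: bclass_def)
    then have "lchain T (Max (bclass T v)) v" using top[OF v(1)] by blast
    then show ?thesis using v(2) by (cases rule: rtranclp.cases) auto
  qed
  show ?thesis
  proof (intro set_eqI iffI)
    fix B assume "B \<in> left_blocks T"
    then obtain v where v: "v \<in> set_tree T" "\<not> (\<exists>u. lchild T v u)" "B = {w. lchain T v w}"
      unfolding left_blocks_def by blast
    then have "B = bclass T v" using topeq[OF v(1,2)] top[OF v(1)] by simp
    then show "B \<in> bclass T ` set_tree T" using v by blast
  next
    fix B assume "B \<in> bclass T ` set_tree T"
    then obtain v where v: "v \<in> set_tree T" "B = bclass T v" by blast
    then have "Max (bclass T v) \<in> set_tree T" using top[OF v(1)] by (auto simp: bclass_def)
    then show "B \<in> left_blocks T" unfolding left_blocks_def using v top[OF v(1)] by blast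
  qed
qed

section \<open>The word of a tree in terms of block minima\<close>

definition rank :: "nat tree \<Rightarrow> nat \<Rightarrow> nat" where
  "rank T i = card {m \<in> bmin T ` set_tree T. m \<le> bmin T i}"

lemma Min_bclass:
  assumes "bst T" "v \<in> set_tree T"
  shows "Min (bclass T v) = bmin T v"
proof (rule Min_eqI)
  show "bmin T v \<in> bclass T v" using assms bmin_in bmin_idem by (auto simp: bclass_def)
  show "bmin T v \<le> y" if "y \<in> bclass T v" for y
    using that assms bmin_le[of T y] by (auto simp: bclass_def)
qed (simp add: bclass_def)

lemma bst_trees_bst: "T \<in> bst_trees n \<Longrightarrow> bst T"
  by (simp add: bst_trees_def bst_iff_sorted_wrt_less del: upt_Suc)

lemma bst_trees_set: "T \<in> bst_trees n \<Longrightarrow> set_tree T = {1..n}"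
  using set_inorder[of T] by (auto simp: bst_trees_def)

lemma length_phiL: "length (phiL n T) = n"
  by (simp add: phiL_def rgs_of_def)

lemma phiL_nth:
  assumes T: "T \<in> bst_trees n" and "i < n"
  shows "phiL n T ! i = rank T (Suc i)"
proof -
  have b: "bst T" and s: "Suc i \<in> set_tree T" using T assms(2) bst_trees_bst bst_trees_set by auto
  have "(THE B. B \<in> bclass T ` set_tree T \<and> Suc i \<in> B) = bclass T (Suc i)"
    by (rule the_equality) (use s in \<open>auto simp: bclass_def\<close>)
  then have "phiL n T ! i = card {B \<in> bclass T ` set_tree T. Min B \<le> bmin T (Suc i)}"
    using assms(2) Min_bclass[OF b s] left_blocks_eq[OF b]
    by (simp add: phiL_def rgs_of_def del: upt_Suc)
  \<comment> \<open>Distinct blocks have distinct minima, so counting blocks amounts to counting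
    minima.\<close>
  also have "\<dots> = card (Min ` {B \<in> bclass T ` set_tree T. Min B \<le> bmin T (Suc i)})"
  proof (rule card_image[symmetric])
    show "inj_on Min {B \<in> bclass T ` set_tree T. Min B \<le> bmin T (Suc i)}"
      by (rule inj_onI) (use Min_bclass[OF b] in \<open>auto simp: bclass_def\<close>)
  qed
  also have "Min ` {B \<in> bclass T ` set_tree T. Min B \<le> bmin T (Suc i)}
      = {m \<in> bmin T ` set_tree T. m \<le> bmin T (Suc i)}"
    using Min_bclass[OF b] by (force simp: image_iff)
  finally show ?thesis unfolding rank_def .
qed

lemma rank_less_iff:
  assumes "j \<in> set_tree T"
  shows "rank T i < rank T j \<longleftrightarrow> bmin T i < bmin T j"
proof
  assume "bmin T i < bmin T j"
  then have "bmin T j \<in> {m \<in> bmin T ` set_tree T. m \<le> bmin T j} - {m \<in> bmin T ` set_tree T. m \<le> bmin T i}"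
    "{m \<in> bmin T ` set_tree T. m \<le> bmin T i} \<subseteq> {m \<in> bmin T ` set_tree T. m \<le> bmin T j}"
    using assms by auto
  then have "{m \<in> bmin T ` set_tree T. m \<le> bmin T i} \<subset> {m \<in> bmin T ` set_tree T. m \<le> bmin T j}"
    by blast
  then show "rank T i < rank T j" unfolding rank_def by (simp add: psubset_card_mono)
next
  assume a: "rank T i < rank T j"
  show "bmin T i < bmin T j"
  proof (rule ccontr)
    assume "\<not> bmin T i < bmin T j"
    then have "{m \<in> bmin T ` set_tree T. m \<le> bmin T j} \<subseteq> {m \<in> bmin T ` set_tree T. m \<le> bmin T i}"
      by auto
    then have "rank T j \<le> rank T i" unfolding rank_def by (simp add: card_mono)
    then show False using a by simp
  qed
qed

lemma phiL_less_iff: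
  assumes "T \<in> bst_trees n" "i < n" "j < n"
  shows "phiL n T ! i < phiL n T ! j \<longleftrightarrow> bmin T (Suc i) < bmin T (Suc j)"
  using assms phiL_nth rank_less_iff bst_trees_set by simp

lemma phiL_eq_iff:
  assumes "T \<in> bst_trees n" "i < n" "j < n"
  shows "phiL n T ! i = phiL n T ! j \<longleftrightarrow> bmin T (Suc i) = bmin T (Suc j)"
  using phiL_less_iff[OF assms] phiL_less_iff[OF assms(1,3,2)] by (metis less_irrefl linorder_neqE)

lemma contains_word_iff_word_emb:
  assumes T: "T \<in> bst_trees n" and P: "P \<in> bst_trees k"
  shows "contains_word (phiL n T) (phiL k P) \<longleftrightarrow> (\<exists>f. word_emb P T f)"
proof
  assume "contains_word (phiL n T) (phiL k P)"
  then obtain idx where idx: "length idx = k" "sorted_wrt (<) idx" "\<forall>a\<in>set idx. a < n"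
    "\<forall>a<k. \<forall>b<k. phiL n T ! (idx ! a) < phiL n T ! (idx ! b) \<longleftrightarrow> phiL k P ! a < phiL k P ! b"
    unfolding contains_word_def length_phiL by blast
  \<comment> \<open>Words are indexed from 0 and vertices from 1, so position \<open>a\<close>
    belongs to vertex \<open>Suc a\<close>.\<close>
  define f where "f i = Suc (idx ! (i - 1))" for i
  have in_n: "idx ! a < n" if "a < k" for a using idx that by simp
  have "f ` set_tree P \<subseteq> set_tree T"
    using in_n bst_trees_set[OF T] bst_trees_set[OF P] by (auto simp: f_def Suc_le_eq)
  moreover have "strict_mono_on (set_tree P) f"
    using idx(1) sorted_wrt_nth_less[OF idx(2)] bst_trees_set[OF P]
    by (auto intro!: strict_mono_onI simp: f_def)
  moreover have "bmin T (f i) < bmin T (f j) \<longleftrightarrow> bmin P i < bmin P j"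
    if ij: "i \<in> set_tree P" "j \<in> set_tree P" for i j
  proof -
    obtain a b where ab: "i = Suc a" "a < k" "j = Suc b" "b < k"
      using ij unfolding bst_trees_set[OF P] by (cases i; cases j) auto
    then show ?thesis
      using idx(4) phiL_less_iff[OF P, of a b] phiL_less_iff[OF T in_n in_n, of a b] by (simp add: f_def)
  qed
  ultimately show "\<exists>f. word_emb P T f" unfolding word_emb_def by blast
next
  assume "\<exists>f. word_emb P T f"
  then obtain f where f: "word_emb P T f" ..
  define idx where "idx = map (\<lambda>a. f (Suc a) - 1) [0..<k]"
  have nth: "idx ! a = f (Suc a) - 1" if "a < k" for a using that by (simp add: idx_def)
  have inP: "Suc a \<in> set_tree P" if "a < k" for a using that bst_trees_set[OF P] by simp
  have fin: "1 \<le> f (Suc a) \<and> f (Suc a) \<le> n" if "a < k" for a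
    using word_emb_in[OF f inP[OF that]] bst_trees_set[OF T] by simp
  have Sn: "Suc (idx ! a) = f (Suc a)" "idx ! a < n" if "a < k" for a
    using fin[OF that] nth[OF that] by auto
  have "sorted_wrt (<) idx"
  proof (subst sorted_wrt_iff_nth_less, intro allI impI)
    fix a b assume "a < b" "b < length idx"
    then have ab: "a < b" "a < k" "b < k" by (auto simp: idx_def)
    then have "f (Suc a) < f (Suc b)" using word_emb_less[OF f inP inP] by simp
    then show "idx ! a < idx ! b" using Sn ab by (metis Suc_less_eq)
  qed
  moreover have "\<forall>a\<in>set idx. a < n" using Sn by (auto simp: in_set_conv_nth idx_def)
  moreover have "(phiL n T ! (idx ! a) < phiL n T ! (idx ! b) \<longleftrightarrow> phiL k P ! a < phiL k P ! b) \<and>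
      (phiL n T ! (idx ! a) = phiL n T ! (idx ! b) \<longleftrightarrow> phiL k P ! a = phiL k P ! b)"
    if "a < k" "b < k" for a b
    using that Sn phiL_less_iff[OF T, of "idx ! a" "idx ! b"] phiL_eq_iff[OF T, of "idx ! a" "idx ! b"]
      phiL_less_iff[OF P, of a b] phiL_eq_iff[OF P, of a b]
      word_emb_bmin_less[OF f, of "Suc a" "Suc b"] word_emb_bmin_eq[OF f, of "Suc a" "Suc b"] inP
    by simp
  ultimately show "contains_word (phiL n T) (phiL k P)"
    unfolding contains_word_def length_phiL
    by (intro exI[of _ idx]) (auto simp: idx_def)
qed

text \<open>A vertex that is not the minimum of its block repeats an earlier letter. A block minimum
  receives one more than the number of smaller block minima, and that number is the letter of the
  largest of them.\<close>

lemma is_rgs_phiL: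
  assumes T: "T \<in> bst_trees n"
  shows "is_rgs (phiL n T)"
  unfolding is_rgs_def length_phiL
proof (intro allI impI)
  fix i assume i: "i < n"
  let ?x = "phiL n T" and ?v = "Suc i"
  let ?I = "bmin T ` set_tree T"
  have b: "bst T" and s: "set_tree T = {1..n}" and v: "?v \<in> set_tree T"
    using T i bst_trees_bst bst_trees_set by auto
  have x: "?x ! i = rank T ?v" using phiL_nth T i by simp
  have mem: "bmin T ?v \<in> {m \<in> ?I. m \<le> bmin T ?v}" using v by auto
  have "0 < card {m \<in> ?I. m \<le> bmin T ?v}" using mem by (subst card_gt_0_iff) auto
  then have "1 \<le> ?x ! i" using x by (simp add: rank_def)
  moreover have "?x ! i \<le> Suc (Max (insert 0 (set (take i ?x))))"
  proof -
    have le: "?x ! j \<le> Max (insert 0 (set (take i ?x)))" if "j < i" for j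
    proof -
      have "?x ! j \<in> set (take i ?x)"
        using that i by (auto simp: in_set_conv_nth length_phiL intro!: exI[of _ j])
      then show ?thesis by simp
    qed
    have m: "bmin T ?v \<in> set_tree T" "bmin T ?v \<le> ?v" using b v bmin_in bmin_le by auto
    show ?thesis
    proof (cases "bmin T ?v = ?v")
      case False
      then obtain j where j: "bmin T ?v = Suc j" "j < i" using m s by (cases "bmin T ?v") auto
      then have "?x ! j = ?x ! i"
        using phiL_eq_iff[OF T, of j i] i bmin_idem[OF b v] by simp
      then show ?thesis using le[OF j(2)] by simp
    next
      case True
      define B where "B = {m \<in> ?I. m \<le> bmin T ?v} - {?v}"
      have card: "?x ! i = Suc (card B)"
        using x mem True unfolding B_def rank_def by (subst card_Suc_Diff1) auto
      show ?thesis
      proof (cases "B = {}")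
        case False
        define M where "M = Max B"
        have fB: "finite B" by (simp add: B_def)
        have memB: "m \<in> B \<longleftrightarrow> m \<in> ?I \<and> m < ?v" for m using True by (auto simp: B_def)
        have MB: "M \<in> B" using False fB unfolding M_def by simp
        then obtain w where w: "w \<in> set_tree T" "M = bmin T w" "M < ?v" unfolding memB by blast
        have "M \<in> {1..n}" using w bmin_in b s by metis
        then obtain j where j: "M = Suc j" "j < i" using w(3) by (cases M) auto
        have "bmin T M = M" using w bmin_idem b by simp
        moreover have "{m \<in> ?I. m \<le> M} = B"
        proof (intro set_eqI iffI)
          fix m assume "m \<in> {m \<in> ?I. m \<le> M}"
          then show "m \<in> B" using w(3) unfolding memB by simp
        next
          fix m assume m: "m \<in> B"
          then have "m \<le> M" using fB unfolding M_def by simp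
          then show "m \<in> {m \<in> ?I. m \<le> M}" using m unfolding memB by simp
        qed
        ultimately have "rank T M = card B" unfolding rank_def by simp
        then have "?x ! j = card B" using phiL_nth[OF T, of j] j i by simp
        then show ?thesis using le[OF j(2)] card by simp
      qed (use card in simp)
    qed
  qed
  ultimately show "1 \<le> ?x ! i \<and> ?x ! i \<le> Suc (Max (insert 0 (set (take i ?x))))" by simp
qed

lemma phiL_avoids_1212:
  assumes T: "T \<in> bst_trees n"
  shows "\<not> contains_word (phiL n T) [1,2,1,2]"
proof
  assume "contains_word (phiL n T) [1,2,1,2]"
  then obtain idx where idx: "length idx = 4" "sorted_wrt (<) idx" "\<forall>a\<in>set idx. a < n"
    and c: "\<forall>a<4. \<forall>b<4. (phiL n T ! (idx ! a) < phiL n T ! (idx ! b) \<longleftrightarrow> [1,2,1,2::nat] ! a < [1,2,1,2] ! b) \<and>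
       (phiL n T ! (idx ! a) = phiL n T ! (idx ! b) \<longleftrightarrow> [1,2,1,2::nat] ! a = [1,2,1,2] ! b)"
    unfolding contains_word_def length_phiL by (auto simp: eval_nat_numeral)
  obtain a b c' d where i: "idx = [a,b,c',d]"
    using idx(1) by (auto simp: numeral_eq_Suc length_Suc_conv)
  have o: "a < b" "b < c'" "c' < d" "d < n" using idx i by auto
  have "phiL n T ! a = phiL n T ! c'" "phiL n T ! b = phiL n T ! d" "phiL n T ! a < phiL n T ! b"
    using c[rule_format, of 0 2] c[rule_format, of 1 3] c[rule_format, of 0 1] i by auto
  then have "bmin T (Suc a) = bmin T (Suc c')" "bmin T (Suc b) = bmin T (Suc d)"
    "bmin T (Suc a) < bmin T (Suc b)"
    using phiL_eq_iff[OF T, of a c'] phiL_eq_iff[OF T, of b d] phiL_less_iff[OF T, of a b] o by auto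
  then show False
    using bmin_noncrossing[OF bst_trees_bst[OF T], of "Suc a" "Suc b" "Suc c'" "Suc d"]
      bst_trees_set[OF T] o by auto
qed

text \<open>Equal words give equal blocks: \<open>bmin T v\<close> lies in the block of
  \<open>v\<close> in \<open>T'\<close> as well and so bounds \<open>bmin T' v\<close> from above.
  By symmetry the minima agree, and they determine the tree.\<close>

lemma inj_phiL: "inj_on (phiL n) (bst_trees n)"
proof (rule inj_onI)
  fix T T' assume T: "T \<in> bst_trees n" and T': "T' \<in> bst_trees n" and e: "phiL n T = phiL n T'"
  have le: "bmin T' v \<le> bmin T v"
    if T: "T \<in> bst_trees n" and T': "T' \<in> bst_trees n" and e: "phiL n T = phiL n T'"
      and v: "v \<in> {1..n}" for T T' v
  proof -
    have b: "bst T" "bst T'" and s: "set_tree T = {1..n}" "set_tree T' = {1..n}"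
      using T T' bst_trees_bst bst_trees_set by auto
    have m: "bmin T v \<in> {1..n}" using bmin_in[OF b(1), of v] s v by simp
    obtain i j where ij: "v = Suc i" "i < n" "bmin T v = Suc j" "j < n"
      using v m by (cases v; cases "bmin T v") auto
    have "phiL n T ! i = phiL n T ! j"
      using phiL_eq_iff[OF T ij(2,4)] ij bmin_idem[OF b(1), of v] s v by simp
    then have "bmin T' v = bmin T' (bmin T v)" using phiL_eq_iff[OF T' ij(2,4)] ij e by simp
    then show ?thesis using bmin_le[OF b(2), of "bmin T v"] m s by simp
  qed
  have "\<forall>v\<in>set_tree T. bmin T v = bmin T' v"
    using le[OF T T' e] le[OF T' T e[symmetric]] bst_trees_set[OF T] by (simp add: le_antisym)
  then show "T = T'" using eq_if_bmin_eq bst_trees_bst[OF T] T T' by (simp add: bst_trees_def)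
qed

text \<open>Each letter exceeds the current maximum by at most one, so no value is skipped; the
  inserted 0 makes the empty prefix give the empty interval.\<close>

lemma is_rgs_set_take:
  assumes "is_rgs x"
  shows "i \<le> length x \<Longrightarrow> set (take i x) = {1..Max (insert 0 (set (take i x)))}"
proof (induction i)
  case (Suc i)
  define S where "S = set (take i x)"
  define M where "M = Max (insert 0 S)"
  have S: "S = {1..M}" using Suc unfolding S_def M_def by simp
  have x: "1 \<le> x ! i" "x ! i \<le> Suc M" using assms Suc.prems unfolding is_rgs_def S_def M_def by auto
  have t: "set (take (Suc i) x) = insert (x ! i) S"
    using Suc.prems by (simp add: take_Suc_conv_app_nth S_def)
  have "finite S" by (simp add: S_def)
  then have "Max (insert 0 (insert (x ! i) S)) = max (x ! i) M"
    unfolding M_def by (simp add: insert_commute[of 0])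
  moreover have "insert (x ! i) S = {1..max (x ! i) M}" using x S by auto
  ultimately show ?case using t by simp
qed simp

text \<open>Reading from left to right, a letter either repeats an earlier one, as dictated by the
  kernel, or is new and then forced to be one above the maximum so far.\<close>

lemma is_rgs_eq_if_same_kernel:
  assumes x: "is_rgs x" and y: "is_rgs y" and len: "length x = length y"
    and ker: "\<And>i j. i < length x \<Longrightarrow> j < length x \<Longrightarrow> x ! i = x ! j \<longleftrightarrow> y ! i = y ! j"
  shows "x = y"
proof -
  have "take i x = take i y" if "i \<le> length x" for i
    using that
  proof (induction i)
    case (Suc i)
    then have IH: "take i x = take i y" and i: "i < length x" by auto
    have nth: "x ! j = y ! j" if "j < i" for j using IH that by (metis nth_take)
    let ?M = "Max (insert 0 (set (take i x)))"
    have fresh: "z ! i = Suc ?M" if z: "is_rgs z" "take i z = take i x" "length z = length x" "z ! i \<notin> set (take i x)" for z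
    proof -
      have "1 \<le> z ! i" "z ! i \<le> Suc ?M" using z i unfolding is_rgs_def by metis+
      moreover have "set (take i x) = {1..?M}" using is_rgs_set_take[OF x] i by simp
      then have "z ! i \<notin> {1..?M}" using z(4) by metis
      ultimately show ?thesis by simp
    qed
    have mem: "z ! i \<in> set (take i z) \<longleftrightarrow> (\<exists>j<i. z ! i = z ! j)" if "length z = length x" for z
      using that i by (auto simp: in_set_conv_nth) 
    have "x ! i = y ! i"
    proof (cases "x ! i \<in> set (take i x)")
      case True
      then obtain j where j: "j < i" "x ! i = x ! j" using mem by auto
      then show ?thesis using ker[of i j] i nth by simp
    next
      case False
      then have "y ! i \<notin> set (take i y)" using mem[of x] mem[of y] len ker i by auto
      then have "y ! i = Suc ?M" using fresh[OF y IH[symmetric] len[symmetric]] unfolding IH by blast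
      moreover have "x ! i = Suc ?M" using fresh[OF x refl refl False] .
      ultimately show ?thesis by simp
    qed
    then show ?case using IH i len by (simp add: take_Suc_conv_app_nth)
  qed simp
  then show ?thesis using len by (metis order_refl take_all)
qed

text \<open>The root is the largest vertex of the block of the least vertex; the noncrossing condition keeps
  the blocks to its right entirely on that side.\<close>

lemma tree_with_bmin_exists:
  fixes m :: "nat \<Rightarrow> nat"
  assumes "\<And>i. a \<le> i \<Longrightarrow> i < b \<Longrightarrow> a \<le> m i \<and> m i \<le> i \<and> m (m i) = m i"
    and "\<And>i j k l. a \<le> i \<Longrightarrow> i < j \<Longrightarrow> j < k \<Longrightarrow> k < l \<Longrightarrow> l < b \<Longrightarrow> m i = m k \<Longrightarrow> m j = m l \<Longrightarrow> m i = m j"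
  shows "\<exists>T. inorder T = [a..<b] \<and> (\<forall>i. a \<le> i \<and> i < b \<longrightarrow> bmin T i = m i)"
  using assms
proof (induction "b - a" arbitrary: a b rule: less_induct)
  case less
  note M = less.prems(1) and N = less.prems(2)
  show ?case
  proof (cases "a < b")
    case False then show ?thesis by (intro exI[of _ Leaf]) auto
  next
    case True
    define A where "A = {i \<in> {a..<b}. m i = a}"
    define v where "v = Max A"
    have "m a = a" using M[of a] True by simp
    then have aA: "a \<in> A" using True by (simp add: A_def)
    have fA: "finite A" by (simp add: A_def)
    then have "v \<in> A" unfolding v_def using aA Max_in by blast
    then have v: "a \<le> v" "v < b" "m v = a" by (auto simp: A_def)
    have vmax: "m i \<noteq> a" if "v < i" "i < b" for i
    proof
      assume "m i = a"
      then have "i \<in> A" using that v by (simp add: A_def)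
      then show False using fA that(1) unfolding v_def by (meson Max_ge leD)
    qed
    have "\<exists>T. inorder T = [a..<v] \<and> (\<forall>i. a \<le> i \<and> i < v \<longrightarrow> bmin T i = m i)"
    proof (rule less.hyps)
      show "v - a < b - a" using v by simp
      show "a \<le> m i \<and> m i \<le> i \<and> m (m i) = m i" if "a \<le> i" "i < v" for i using M that v by simp
      show "m i = m j" if "a \<le> i" "i < j" "j < k" "k < l" "l < v" "m i = m k" "m j = m l" for i j k l
        using N[of i j k l] that v by simp
    qed
    then obtain L where L: "inorder L = [a..<v]" "\<And>i. a \<le> i \<Longrightarrow> i < v \<Longrightarrow> bmin L i = m i" by blast
    have "\<exists>T. inorder T = [Suc v..<b] \<and> (\<forall>i. Suc v \<le> i \<and> i < b \<longrightarrow> bmin T i = m i)"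
    proof (rule less.hyps)
      show "b - Suc v < b - a" using v by simp
      show "Suc v \<le> m i \<and> m i \<le> i \<and> m (m i) = m i" if "Suc v \<le> i" "i < b" for i
      proof -
        have mi: "a \<le> m i" "m i \<le> i" "m (m i) = m i" "m i \<noteq> a" using M[of i] vmax[of i] that v by auto
        have "v < m i"
        proof (rule ccontr)
          assume "\<not> v < m i"
          then have "m i < v" using v mi by (cases "m i = v") auto
          \<comment> \<open>Otherwise \<open>a < m i < v < i\<close> would be a crossing of the
            blocks of \<open>a\<close> and \<open>i\<close>.\<close>
          then have "m a = m (m i)" using N[of a "m i" v i] mi that v \<open>m a = a\<close> by simp
          then show False using mi \<open>m a = a\<close> by simp
        qed
        then show ?thesis using mi by simp
      qed
      show "m i = m j" if "Suc v \<le> i" "i < j" "j < k" "k < l" "l < b" "m i = m k" "m j = m l" for i j k l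
        using N[of i j k l] that v by simp
    qed
    then obtain R where R: "inorder R = [Suc v..<b]" "\<And>i. Suc v \<le> i \<Longrightarrow> i < b \<Longrightarrow> bmin R i = m i" by blast
    have "[a..<b] = [a..<v] @ v # [Suc v..<b]"
      using v upt_add_eq_append[of a v "b - v"] upt_conv_Cons[of v b] by simp
    then have "inorder (Node L v R) = [a..<b]" using L R by simp
    \<comment> \<open>The left branch from \<open>v\<close> must end in \<open>a\<close>: either
      \<open>L\<close> is empty and \<open>v = a\<close>, or \<open>a\<close> is the least vertex of
      \<open>L\<close>.\<close>
    moreover have "bmin (Node L v R) v = m v"
    proof (cases "L = Leaf")
      case True
      then have "[a..<v] = []" using L(1) by simp
      then have "v = a" using v(1) by auto
      then show ?thesis using True v by simp
    next
      case False
      have bL: "bst L" using L(1) by (simp add: bst_iff_sorted_wrt_less)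
      have sL: "set_tree L = {a..<v}" using L(1) set_inorder[of L] by simp
      have "bmin L (value L) \<in> {a..<v}" using bmin_in[OF bL value_in_set_tree[OF False]] sL by simp
      then have "bmin L (value L) = a" using bmin_root_le[OF bL, of a] sL by auto
      then show ?thesis using False v by simp
    qed
    ultimately show ?thesis using L R by (intro exI[of _ "Node L v R"]) auto
  qed
qed

text \<open>A crossing of the form 2121 is turned into 1212 by the restricted growth property, which supplies
  an earlier occurrence of the smaller letter.\<close>

lemma is_rgs_noncrossing:
  assumes x: "is_rgs x" and av: "\<not> contains_word x [1,2,1,2]"
    and o: "i < j" "j < k" "k < l" "l < length x" "x ! i = x ! k" "x ! j = x ! l"
  shows "x ! i = x ! j"
proof (rule ccontr)
  have no: False if "a < b" "b < c" "c < d" "d < length x" "x ! a = x ! c" "x ! b = x ! d" "x ! a < x ! b" for a b c d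
  proof -
    have p: "x ! ([a,b,c,d] ! p) = (if even p then x ! a else x ! b) \<and>
        [1,2,1,2] ! p = (if even p then 1 else 2 :: nat)" if "p < 4" for p
    proof -
      consider "p = 0" | "p = 1" | "p = 2" | "p = 3" using \<open>p < 4\<close> by linarith
      then show ?thesis using \<open>x ! a = x ! c\<close> \<open>x ! b = x ! d\<close> by cases simp_all
    qed
    have "contains_word x [1,2,1,2]"
      unfolding contains_word_def
    proof (intro exI[of _ "[a,b,c,d]"] conjI allI impI)
      fix p q :: nat assume "p < length [1,2,1,2::nat]" "q < length [1,2,1,2::nat]"
      then have pq: "p < 4" "q < 4" by simp_all
      show "(x ! ([a,b,c,d] ! p) < x ! ([a,b,c,d] ! q)) = ([1,2,1,2::nat] ! p < [1,2,1,2] ! q)"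
        "(x ! ([a,b,c,d] ! p) = x ! ([a,b,c,d] ! q)) = ([1,2,1,2::nat] ! p = [1,2,1,2] ! q)"
        unfolding p[OF pq(1), THEN conjunct1] p[OF pq(1), THEN conjunct2]
          p[OF pq(2), THEN conjunct1] p[OF pq(2), THEN conjunct2]
        using \<open>x ! a < x ! b\<close> by auto
    qed (use that in auto)
    then show False using av by simp
  qed
  assume "x ! i \<noteq> x ! j"
  then consider "x ! i < x ! j" | "x ! j < x ! i" by linarith
  then show False
  proof cases
    case 1 then show ?thesis using no[of i j k l] o by simp
  next
    case 2
    let ?S = "set (take i x)"
    have "x ! i \<le> Suc (Max (insert 0 ?S))" "1 \<le> x ! j" using x o(1-4) unfolding is_rgs_def by auto
    then have "x ! j \<in> {1..Max (insert 0 ?S)}" using 2 by simp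
    moreover have "?S = {1..Max (insert 0 ?S)}" using is_rgs_set_take[OF x, of i] o by simp
    ultimately have "x ! j \<in> ?S" by metis
    then obtain h where "h < i" "x ! h = x ! j" using o by (auto simp: in_set_conv_nth)
    then show ?thesis using no[of h i j k] o 2 by simp
  qed
qed

text \<open>The first occurrence of each letter becomes the minimum of its block. The resulting tree
  has a word with the same kernel as \<open>x\<close>, and growth strings with equal kernels
  coincide.\<close>

lemma phiL_surj:
  assumes x: "is_rgs x" and av: "\<not> contains_word x [1,2,1,2]" and len: "length x = n"
  shows "\<exists>T\<in>bst_trees n. phiL n T = x"
proof -
  define g where "g i = (LEAST j. x ! j = x ! i)" for i
  have g: "x ! g i = x ! i" "g i \<le> i" for i unfolding g_def by (auto intro: LeastI Least_le)
  have geq: "g i = g j \<longleftrightarrow> x ! i = x ! j" for i j using g(1) unfolding g_def by metis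
  define m where "m i = Suc (g (i - 1))" for i
  have "\<exists>T. inorder T = [1..<n+1] \<and> (\<forall>i. 1 \<le> i \<and> i < n+1 \<longrightarrow> bmin T i = m i)"
  proof (rule tree_with_bmin_exists)
    show "1 \<le> m i \<and> m i \<le> i \<and> m (m i) = m i" if "1 \<le> i" "i < n + 1" for i
      using g[of "i - 1"] geq that unfolding m_def by auto
    show "m i = m j" if "1 \<le> i" "i < j" "j < k" "k < l" "l < n+1" "m i = m k" "m j = m l" for i j k l
    proof -
      have "x ! (i - 1) = x ! (j - 1)"
        using is_rgs_noncrossing[OF x av, of "i - 1" "j - 1" "k - 1" "l - 1"] that len geq
        unfolding m_def by auto
      then show ?thesis using geq unfolding m_def by simp
    qed
  qed
  then obtain T where T: "inorder T = [1..<n+1]" "\<And>i. 1 \<le> i \<Longrightarrow> i < n+1 \<Longrightarrow> bmin T i = m i" by blast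
  then have bt: "T \<in> bst_trees n" by (simp add: bst_trees_def)
  have "phiL n T = x"
  proof (rule is_rgs_eq_if_same_kernel)
    show "phiL n T ! i = phiL n T ! j \<longleftrightarrow> x ! i = x ! j"
      if "i < length (phiL n T)" "j < length (phiL n T)" for i j
      using phiL_eq_iff[OF bt, of i j] that T(2)[of "Suc i"] T(2)[of "Suc j"] geq
      by (simp add: length_phiL m_def)
  qed (use is_rgs_phiL[OF bt] x len length_phiL in auto)
  then show ?thesis using bt by blast
qed

section \<open>Restricting the bijection to avoiders\<close>

theorem theorem15:
  fixes P :: "nat tree" and k :: nat and e :: "nat \<Rightarrow> bool"
    and as bs :: "nat list"
  assumes "P \<in> bst_trees k"
    and "stag e P as bs"
    and "length as > 1 \<and> bs ! 0 = as ! 0 \<longrightarrow> as ! 0 \<in> {1, 2}"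
    and "\<forall>i. 2 \<le> i \<and> i \<le> length as - 1 \<longrightarrow> bs ! (i - 1) < as ! (i - 1)"
  shows "\<forall>n. bij_betw (phiL n) (avoiders n P e) (rgs_avoiding n (phiL k P))"
proof
  fix n
  have P: "bst P" "P \<noteq> Leaf" using bst_trees_bst assms(1,2) stag_nonempty by blast+
  have shape: "stag_shape P" "right P \<noteq> Leaf \<longrightarrow> size (left P) \<le> 1"
    using stag_shape_if_stag[OF assms(2-4)] by blast+
  \<comment> \<open>Containment corresponds under \<open>phiL\<close>, so the bijection between all
    search trees and all 1212-avoiding growth strings restricts to the avoiders.\<close>
  have iff: "contains_pattern T P e \<longleftrightarrow> contains_word (phiL n T) (phiL k P)" if T: "T \<in> bst_trees n" for T
  proof -
    have b: "bst T" using T bst_trees_bst by blast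
    have "contains_pattern T P e \<longleftrightarrow> occurs_in P T"
      using contains_pattern_iff_occurs_in[OF P(1) b]
        stag_contiguous_left[OF assms(2)] stag_noncontiguous_right[OF assms(2)] by blast
    also have "\<dots> \<longleftrightarrow> (\<exists>f. word_emb P T f)" using occurs_in_iff_word_emb[OF P(1) shape(1) P(2) shape(2) b] .
    also have "\<dots> \<longleftrightarrow> contains_word (phiL n T) (phiL k P)"
      using contains_word_iff_word_emb[OF T assms(1)] by blast
    finally show ?thesis .
  qed
  show "bij_betw (phiL n) (avoiders n P e) (rgs_avoiding n (phiL k P))"
    unfolding bij_betw_def
  proof
    show "inj_on (phiL n) (avoiders n P e)"
      using inj_phiL by (rule inj_on_subset) (auto simp: avoiders_def)
    show "phiL n ` avoiders n P e = rgs_avoiding n (phiL k P)"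
    proof (intro set_eqI iffI)
      fix x assume "x \<in> phiL n ` avoiders n P e"
      then obtain T where "T \<in> bst_trees n" "\<not> contains_pattern T P e" "x = phiL n T"
        by (auto simp: avoiders_def)
      then show "x \<in> rgs_avoiding n (phiL k P)"
        using iff is_rgs_phiL phiL_avoids_1212 length_phiL by (auto simp: rgs_avoiding_def)
    next
      fix x assume x: "x \<in> rgs_avoiding n (phiL k P)"
      then obtain T where "T \<in> bst_trees n" "phiL n T = x"
        using phiL_surj[of x n] by (auto simp: rgs_avoiding_def)
      then show "x \<in> phiL n ` avoiders n P e"
        using iff x by (auto simp: rgs_avoiding_def avoiders_def)
    qed
  qed
qed

end
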